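(* Let $p$ be an odd prime and $n$ a positive integer. Then $$S_{np}-S_n\equiv\begin{cases} 8n^2S_{n-1}(-1)^{\frac{p-1}{2}}p^2E_{p-3}\pmod{p^3} & \text{if } p>3 \text{ and } p\nmid n,\\ 9(n-1)S_n \pmod{p^3} & \text{if } p=3 \text{ and } 3\nmid n,\\ 0 \pmod{p^{3+\mathrm{ord}_p n}} & \text{if } p\mid n.\end{cases}$$
   Context: $(S_n)_{n\ge0}$ is the integer sequence defined by $S_0=1$, $S_1=4$ and $(n+1)^2S_{n+1}=4(3n^2+3n+1)S_n-32n^2S_{n-1}$ for $n\ge1$; equivalently $S_n=\sum_{k=0}^n\binom nk\binom{2k}k\binom{2n-2k}{n-k}$. The Euler numbers $E_n$ are defined by $E_0=1$, $E_{2n-1}=0$ and $\sum_{k=0}^n\binom{2n}{2k}E_{2k}=0$ for $n\ge1$. For a positive integer $n$, $\mathrm{ord}_p n$ is the largest integer $\alpha\ge0$ with $p^\alpha\mid n$. *)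

theory Defs
  imports "HOL-Computational_Algebra.Computational_Algebra" "HOL-Number_Theory.Number_Theory"
begin

definition S :: "nat \<Rightarrow> int" where
  "S n = (\<Sum>k\<le>n. int (n choose k) * int ((2*k) choose k) * int ((2*n - 2*k) choose (n - k)))"

fun euler_even :: "nat \<Rightarrow> int" where
  "euler_even n = (if n = 0 then 1 else
     - (\<Sum>k<n. int ((2*n) choose (2*k)) * euler_even k))"

declare euler_even.simps[simp del]

definition E :: "nat \<Rightarrow> int" where
  "E m = (if even m then euler_even (m div 2) else 0)"

end

theory Submission
  imports Defs
begin

text \<open>
  Split \<open>S (n p) = \<Sum>\<^sub>k C(np,k) C(2k,k) C(2np-2k,np-k)\<close> according to whether \<open>p\<close> divides \<open>k\<close>.

  For \<open>k = p a\<close>, every binomial coefficient \<open>C(p(a+b), pa)\<close> equals \<open>C(a+b,a) R(a+b) / (R(a) R(b))\<close>,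
  where \<open>R(a)\<close> is the product of the numbers up to \<open>p a\<close> prime to \<open>p\<close>. Pairing \<open>pj+r\<close> with
  \<open>pj+p-r\<close> shows that the block \<open>\<Prod>\<^sub>r (pj+r)\<close> is a polynomial in \<open>p\<^sup>2 j(j+1)\<close> whose linear
  coefficient is divisible by \<open>p\<close> if \<open>p > 3\<close>; hence \<open>R(a+b) \<equiv> R(a) R(b) (1 + D a b (a+b))\<close> modulo
  \<open>p\<^sup>3 a\<close> with \<open>D = 0\<close> for \<open>p > 3\<close> and \<open>D = -9\<close> for \<open>p = 3\<close>. The factor \<open>a\<close> in the modulus is
  absorbed by \<open>a C(n,a) = n C(n-1,a-1)\<close>, which yields the extra power of \<open>p\<close> dividing \<open>n\<close>.

  For \<open>k = pa+r\<close> with \<open>0 < r < p\<close>, the factor \<open>C(np,k)\<close> contributes \<open>np\<close> and one of the two central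
  binomial coefficients contributes a carry, so \<open>p\<^sup>2 n\<close> divides the term up to units. Using
  \<open>r C(2r,r) C(2p-2r,p-r) \<equiv> -2p\<close> modulo \<open>p\<^sup>2\<close> for \<open>r < p/2\<close>, these terms add up to
  \<open>4 n\<^sup>2 p\<^sup>2 S (n-1) H\<close>, where \<open>H = \<Sum>\<^sub>r (-1)\<^sup>r / r\<^sup>2\<close> over \<open>0 < r < p/2\<close>. Writing \<open>1/r\<^sup>2\<close> as
  \<open>r^(p-3)\<close>, telescoping with the Euler polynomials gives \<open>H \<equiv> 2 (-1)^((p-1)/2) E (p-3)\<close>.
\<close>

section \<open>Euler polynomials\<close>

lemma even_binomial_sum:
  fixes x :: int
  shows "(x + 1) ^ (2*i) + (x - 1) ^ (2*i) = 2 * (\<Sum>l\<le>i. int ((2*i) choose (2*l)) * x ^ (2*l))"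
proof -
  let ?f = "\<lambda>k. int ((2*i) choose k) * x ^ k * (1 + (-1) ^ (2*i - k))"
  have "(x + 1) ^ (2*i) + (x - 1) ^ (2*i) = (\<Sum>k\<le>2*i. ?f k)"
    using binomial_ring[of x 1 "2*i"] binomial_ring[of x "-1" "2*i"]
    by (simp add: sum.distrib algebra_simps)
  also have "\<dots> = (\<Sum>k\<in>(\<lambda>l. 2*l) ` {..i}. ?f k)"
  proof (rule sum.mono_neutral_right)
    show "\<forall>k\<in>{..2*i} - (\<lambda>l. 2*l) ` {..i}. ?f k = 0"
    proof
      fix k assume k: "k \<in> {..2*i} - (\<lambda>l. 2*l) ` {..i}"
      have "odd k"
      proof
        assume "even k"
        then obtain l where "k = 2*l" by (elim evenE)
        with k show False by auto
      qed
      with k have "odd (2*i - k)" by auto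
      then show "?f k = 0" by simp
    qed
  qed auto
  also have "\<dots> = (\<Sum>l\<le>i. ?f (2*l))"
    by (subst sum.reindex) (auto simp: inj_on_def)
  also have "\<dots> = (\<Sum>l\<le>i. 2 * (int ((2*i) choose (2*l)) * x ^ (2*l)))"
    by (rule sum.cong) auto
  finally show ?thesis by (simp add: sum_distrib_left)
qed

lemma euler_even_sum:
  "(\<Sum>k\<le>n. int ((2*n) choose (2*k)) * euler_even k) = (if n = 0 then 1 else 0)"
proof (cases "n = 0")
  case True
  then show ?thesis by (simp add: euler_even.simps)
next
  case False
  then show ?thesis
    using euler_even.simps[of n] by (simp add: lessThan_Suc_atMost[symmetric])
qed

text \<open>
  \<open>euler_poly n x\<close> is \<open>2^(2n)\<close> times the classical Euler polynomial of degree \<open>2n\<close> at \<open>(x+1)/2\<close>.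
\<close>

definition euler_poly :: "nat \<Rightarrow> int \<Rightarrow> int" where
  "euler_poly n x = (\<Sum>k\<le>n. int ((2*n) choose (2*k)) * euler_even k * x ^ (2*(n - k)))"

text \<open>Both sides equal the multinomial coefficient
  \<open>n! / (k! l! (n-k-l)!)\<close>.\<close>

lemma binomial_swap:
  assumes "k + l \<le> (n::nat)"
  shows "(n choose k) * ((n - k) choose l) = (n choose l) * ((n - l) choose k)"
proof -
  have 1: "fact k * (fact l * fact (n - k - l)) * ((n choose k) * ((n - k) choose l)) = (fact n :: nat)"
    using binomial_fact_lemma[of k n] binomial_fact_lemma[of l "n - k"] assms
    by (metis (no_types, opaque_lifting) add_leD1 add_le_imp_le_diff le_add2 le_add_diff_inverse add.commute mult.assoc mult.commute mult.left_commute)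
  have 2: "fact l * (fact k * fact (n - l - k)) * ((n choose l) * ((n - l) choose k)) = (fact n :: nat)"
    using binomial_fact_lemma[of l n] binomial_fact_lemma[of k "n - l"] assms
    by (metis (no_types, opaque_lifting) add_leD2 add_le_imp_le_diff le_add2 le_add_diff_inverse add.commute mult.assoc mult.commute mult.left_commute)
  have "n - k - l = n - l - k" by simp
  with 1 2 have "(fact k * fact l * fact (n - k - l)) * ((n choose k) * ((n - k) choose l)) =
    (fact k * fact l * fact (n - k - l)) * ((n choose l) * ((n - l) choose k))"
    by (simp add: ac_simps)
  then show ?thesis by simp
qed

lemma sum_triangle_swap:
  fixes g :: "nat \<Rightarrow> nat \<Rightarrow> 'a::comm_monoid_add"
  shows "(\<Sum>k\<le>n. \<Sum>l\<le>n-k. g k l) = (\<Sum>l\<le>n. \<Sum>k\<le>n-l. g k l)"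
proof -
  have "{l. l \<in> {..n} \<and> k + l \<le> n} = {..n - k}" "{l. l \<in> {..n} \<and> l + k \<le> n} = {..n - k}"
    if "k \<le> n" for k
    using that by auto
  then show ?thesis
    using sum.swap_restrict[of "{..n}" "{..n}" g "\<lambda>k l. k + l \<le> n"] by simp
qed

text \<open>The scaled form of the classical E(x+1) + E(x) = 2 x^(2n). Expanding the even powers and
  exchanging the sums turns the coefficient of \<open>x ^ (2*l)\<close> into the defining recurrence
  of the Euler numbers, which vanishes unless \<open>l = n\<close>.\<close>

lemma euler_poly_add:
  "euler_poly n (x + 1) + euler_poly n (x - 1) = 2 * x ^ (2*n)"
proof -
  let ?e = "\<lambda>k. euler_even k"
  have "euler_poly n (x + 1) + euler_poly n (x - 1) =
    (\<Sum>k\<le>n. int ((2*n) choose (2*k)) * ?e k * ((x + 1) ^ (2*(n - k)) + (x - 1) ^ (2*(n - k))))"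
    by (simp add: euler_poly_def sum.distrib algebra_simps)
  also have "\<dots> = (\<Sum>k\<le>n. \<Sum>l\<le>n-k. 2 * (int ((2*n) choose (2*k)) * int ((2*(n - k)) choose (2*l))) * ?e k * x ^ (2*l))"
    unfolding even_binomial_sum by (simp add: sum_distrib_left mult_ac)
  also have "\<dots> = (\<Sum>k\<le>n. \<Sum>l\<le>n-k. 2 * x ^ (2*l) * int ((2*n) choose (2*l)) * (int ((2*(n - l)) choose (2*k)) * ?e k))"
  proof (intro sum.cong refl)
    fix k l assume "k \<in> {..n}" "l \<in> {..n - k}"
    then have "2*k + 2*l \<le> 2*n" by auto
    from binomial_swap[OF this]
    have "int ((2*n) choose (2*k)) * int ((2*(n - k)) choose (2*l)) = int ((2*n) choose (2*l)) * int ((2*(n - l)) choose (2*k))"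
      by (simp flip: of_nat_mult add: diff_mult_distrib2)
    then show "2 * (int ((2*n) choose (2*k)) * int ((2*(n - k)) choose (2*l))) * ?e k * x ^ (2*l) =
      2 * x ^ (2*l) * int ((2*n) choose (2*l)) * (int ((2*(n - l)) choose (2*k)) * ?e k)"
      by simp
  qed
  also have "\<dots> = (\<Sum>l\<le>n. \<Sum>k\<le>n-l. 2 * x ^ (2*l) * int ((2*n) choose (2*l)) * (int ((2*(n - l)) choose (2*k)) * ?e k))"
    by (rule sum_triangle_swap)
  also have "\<dots> = (\<Sum>l\<le>n. if l = n then 2 * x ^ (2*n) else 0)"
    by (rule sum.cong) (auto simp: sum_distrib_left[symmetric] euler_even_sum)
  finally show ?thesis by simp
qed

text \<open>Telescoping of \<open>euler_poly_add\<close> at the odd points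
  \<open>2*j + 1\<close>.\<close>

lemma alternating_odd_power_sum:
  "2 * (\<Sum>j<m. (-1) ^ j * (2 * int j + 1) ^ (2*n)) = euler_poly n 0 - (-1) ^ m * euler_poly n (2 * int m)"
proof (induction m)
  case (Suc m)
  show ?case
    using Suc arg_cong[OF euler_poly_add[of n "2 * int m + 1"], of "\<lambda>z. (-1) ^ m * z"]
    by (simp add: algebra_simps)
qed simp

lemma euler_poly_0: "euler_poly n 0 = euler_even n"
proof -
  have "euler_poly n 0 = (\<Sum>k\<le>n. if k = n then euler_even n else 0)"
    unfolding euler_poly_def by (rule sum.cong) auto
  then show ?thesis by simp
qed

lemma euler_poly_minus_1: "n > 0 \<Longrightarrow> euler_poly n (-1) = 0"
  using euler_even_sum[of n] by (simp add: euler_poly_def)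

lemma euler_poly_cong:
  "[x = y] (mod q) \<Longrightarrow> [euler_poly n x = euler_poly n y] (mod q)"
  unfolding euler_poly_def by (intro cong_sum cong_mult cong_refl cong_pow)

text \<open>The upper boundary term of the telescoped sum vanishes: modulo \<open>2*m + 1\<close>
  its argument \<open>2*m\<close> is -1, a zero of \<open>euler_poly n\<close> for positive
  \<open>n\<close>.\<close>

lemma euler_even_cong_odd_power_sum:
  fixes m n :: nat
  assumes "n > 0"
  shows "[2 * (\<Sum>j<m. (-1) ^ j * (2 * int j + 1) ^ (2*n)) = euler_even n] (mod (2 * int m + 1))"
proof -
  have "[2 * int m = -1] (mod (2 * int m + 1))"
    by (simp add: cong_iff_dvd_diff)
  from euler_poly_cong[OF this, of n] have "[euler_poly n (2 * int m) = 0] (mod (2 * int m + 1))"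
    using assms by (simp add: euler_poly_minus_1)
  then have "[euler_poly n 0 - (-1) ^ m * euler_poly n (2 * int m) = euler_poly n 0 - (-1) ^ m * 0] (mod (2 * int m + 1))"
    by (intro cong_diff cong_mult cong_refl)
  then show ?thesis
    by (simp add: alternating_odd_power_sum euler_poly_0)
qed

lemma fermat_int:
  fixes p :: nat and x :: int
  assumes "prime p" "\<not> int p dvd x"
  shows "[x ^ (p - 1) = 1] (mod int p)"
proof -
  let ?y = "nat (x mod int p)"
  have p: "p > 0" using assms(1) prime_gt_0_nat by blast
  have y: "int ?y = x mod int p" using p by simp
  have "\<not> p dvd ?y"
  proof
    assume "p dvd ?y"
    then have "int p dvd x mod int p" using y by (metis int_dvd_int_iff)
    then show False using assms(2) by (simp add: dvd_mod_iff)
  qed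
  from fermat_theorem[OF assms(1) this] have "[int ?y ^ (p - 1) = 1] (mod int p)"
    by (metis cong_int_iff of_nat_1 of_nat_power)
  then show ?thesis using y by (simp add: cong_def power_mod)
qed

section \<open>Power sums modulo a prime\<close>

lemma even_power_reflect_cong:
  "even k \<Longrightarrow> [(q - x) ^ k = x ^ k] (mod (q::int))"
proof -
  assume k: "even k"
  have "[q - x = - x] (mod q)" by (simp add: cong_iff_dvd_diff)
  from cong_pow[OF this, of k] show ?thesis using k by simp
qed

text \<open>Here \<open>2 * (m - 1)\<close> is \<open>p - 3\<close>, so the left side is 2^(p-1).
  The same exponent represents 1/r^2 modulo \<open>p\<close> in what follows.\<close>

lemma four_two_power_cong:
  fixes m p :: nat
  assumes "prime p" "p = 2 * m + 1" "m > 1"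
  shows "[4 * 2 ^ (2 * (m - 1)) = (1::int)] (mod int p)"
proof -
  have "\<not> p dvd 2" using assms by (auto dest: dvd_imp_le)
  then have "\<not> int p dvd 2" by (metis int_dvd_int_iff of_nat_numeral)
  from fermat_int[OF assms(1) this] have "[2 ^ (2 * m) = (1::int)] (mod int p)"
    using assms by simp
  moreover have "(2::int) ^ (2 * m) = 2 ^ (2 * (m - 1) + 2)"
    by (rule arg_cong[where f = "\<lambda>k. 2 ^ k"]) (use assms in simp)
  ultimately show ?thesis by (simp add: power_add mult.commute)
qed

text \<open>Reversing the order by j = m - r turns 2j + 1 into p - 2r, which to an even power may be
  replaced by 2r. This relates the sum over odd numbers to 2^(p-3) times the sum wanted.\<close>

lemma alternating_power_sum_cong_euler:
  fixes m p :: nat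
  assumes "prime p" "p = 2 * m + 1" "m > 1"
  shows "[(\<Sum>r=1..m. (-1) ^ r * int r ^ (2 * (m - 1))) = 2 * (-1) ^ m * euler_even (m - 1)] (mod int p)"
proof -
  define N where "N = 2 * (m - 1)"
  define H where "H = (\<Sum>r=1..m. (-1) ^ r * int r ^ N)"
  have "even N" by (simp add: N_def)
  have "(\<Sum>j<m. (-1) ^ j * (2 * int j + 1) ^ N) = (\<Sum>r=1..m. (-1) ^ (m - r) * (2 * int (m - r) + 1) ^ N)"
    by (rule sum.reindex_bij_witness[of _ "\<lambda>r. m - r" "\<lambda>j. m - j"]) auto
  also have "\<dots> = (\<Sum>r=1..m. (-1) ^ m * ((-1) ^ r * (int p - 2 * int r) ^ N))"
  proof (rule sum.cong)
    fix r assume r: "r \<in> {1..m}"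
    have "(-1::int) ^ (m - r) = (-1) ^ m * (-1) ^ r"
      using r by (simp add: minus_one_power_iff)
    moreover have "2 * int (m - r) + 1 = int p - 2 * int r"
      using r assms by (simp add: of_nat_diff)
    ultimately show "(-1) ^ (m - r) * (2 * int (m - r) + 1) ^ N = (-1) ^ m * ((-1) ^ r * (int p - 2 * int r) ^ N)"
      by simp
  qed simp
  also have "[\<dots> = (\<Sum>r=1..m. (-1) ^ m * ((-1) ^ r * (2 * int r) ^ N))] (mod int p)"
    by (intro cong_sum cong_mult cong_refl even_power_reflect_cong \<open>even N\<close>)
  also have "(\<Sum>r=1..m. (-1) ^ m * ((-1) ^ r * (2 * int r) ^ N)) = (-1) ^ m * 2 ^ N * H"
    by (simp add: H_def sum_distrib_left power_mult_distrib algebra_simps)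
  finally have 1: "[(\<Sum>j<m. (-1) ^ j * (2 * int j + 1) ^ N) = (-1) ^ m * 2 ^ N * H] (mod int p)" .
  have "[2 * (\<Sum>j<m. (-1) ^ j * (2 * int j + 1) ^ N) = euler_even (m - 1)] (mod int p)"
    using euler_even_cong_odd_power_sum[of "m - 1" m] assms by (simp add: N_def add.commute)
  with cong_scalar_left[OF 1, of 2] have "[euler_even (m - 1) = 2 * ((-1) ^ m * 2 ^ N * H)] (mod int p)"
    using cong_sym cong_trans by blast
  \<comment> \<open>This multiplier squares the sign away and completes 2^(p-3) to
    \<open>4 * 2 ^ N\<close>, which is 1 modulo \<open>p\<close>.\<close>
  from cong_scalar_left[OF this, of "2 * (-1) ^ m"]
  have "[2 * (-1) ^ m * euler_even (m - 1) = (4 * 2 ^ N) * H] (mod int p)"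
    by (simp add: algebra_simps flip: power_add)
  also have "[(4 * 2 ^ N) * H = 1 * H] (mod int p)"
    unfolding N_def by (intro cong_mult four_two_power_cong cong_refl assms)
  finally show ?thesis by (simp add: H_def N_def cong_sym_eq)
qed

section \<open>Splittings of sums and products over the nonzero residues\<close>

lemma sum_split_half:
  fixes f :: "nat \<Rightarrow> 'a::comm_monoid_add"
  assumes "p = 2 * m + 1"
  shows "(\<Sum>r=1..<p. f r) = (\<Sum>r=1..m. f r) + (\<Sum>r=1..m. f (p - r))"
proof -
  have "{1..<p} = {1..m} \<union> {m+1..2*m}" using assms by auto
  then have "(\<Sum>r=1..<p. f r) = (\<Sum>r=1..m. f r) + (\<Sum>r=m+1..2*m. f r)"
    by (simp add: sum.union_disjoint)
  also have "(\<Sum>r=m+1..2*m. f r) = (\<Sum>r=1..m. f (p - r))"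
    by (rule sum.reindex_bij_witness[of _ "\<lambda>r. p - r" "\<lambda>r. p - r"]) (use assms in auto)
  finally show ?thesis .
qed

lemma prod_split_half:
  fixes f :: "nat \<Rightarrow> 'a::comm_monoid_mult"
  assumes "p = 2 * m + 1"
  shows "(\<Prod>r=1..<p. f r) = (\<Prod>r=1..m. f r * f (p - r))"
proof -
  have "{1..<p} = {1..m} \<union> {m+1..2*m}" using assms by auto
  then have "(\<Prod>r=1..<p. f r) = (\<Prod>r=1..m. f r) * (\<Prod>r=m+1..2*m. f r)"
    by (simp add: prod.union_disjoint)
  also have "(\<Prod>r=m+1..2*m. f r) = (\<Prod>r=1..m. f (p - r))"
    by (rule prod.reindex_bij_witness[of _ "\<lambda>r. p - r" "\<lambda>r. p - r"]) (use assms in auto)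
  finally show ?thesis by (simp add: prod.distrib)
qed

text \<open>The odd numbers below \<open>p\<close> are written as \<open>p - 2 * r\<close>, so that
  reflection sends them to the even ones.\<close>

lemma sum_split_parity:
  fixes f :: "nat \<Rightarrow> 'a::comm_monoid_add"
  assumes "p = 2 * m + 1"
  shows "(\<Sum>r=1..<p. f r) = (\<Sum>r=1..m. f (2 * r)) + (\<Sum>r=1..m. f (p - 2 * r))"
proof -
  have "(\<Sum>r=1..m. f (p - 2 * r)) = (\<Sum>r=1..m. f (2 * r - 1))"
    by (rule sum.reindex_bij_witness[of _ "\<lambda>r. m + 1 - r" "\<lambda>r. m + 1 - r"])
       (use assms in \<open>auto intro!: arg_cong[where f = f]\<close>)
  moreover have "(\<Sum>r=1..<2*m+1. f r) = (\<Sum>r=1..m. f (2 * r)) + (\<Sum>r=1..m. f (2 * r - 1))"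
    by (induction m) (simp_all add: ac_simps)
  ultimately show ?thesis using assms by simp
qed

text \<open>With A the half sum, the full sum over the nonzero residues is 2A when split into halves
  and 2 * 2^(p-3) A when split by parity. Doubling and using 4 * 2^(p-3) = 1 gives 4A = A, hence 3A
  = 0 modulo \<open>p\<close>, where \<open>p > 3\<close>.\<close>

lemma half_power_sum_cong_0:
  fixes m p :: nat
  assumes "prime p" "p = 2 * m + 1" "m > 1"
  shows "[(\<Sum>r=1..m. int r ^ (2 * (m - 1))) = 0] (mod int p)"
proof -
  define N where "N = 2 * (m - 1)"
  define A where "A = (\<Sum>r=1..m. int r ^ N)"
  have "even N" by (simp add: N_def)
  have refl: "[(\<Sum>r=1..m. int (p - c * r) ^ N) = (\<Sum>r=1..m. int (c * r) ^ N)] (mod int p)" if "c \<le> 2" for c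
  proof (rule cong_sum)
    fix r assume r: "r \<in> {1..m}"
    have "c * r \<le> 2 * m" using that r by (intro mult_mono) auto
    then have "int (p - c * r) = int p - int (c * r)" using assms by (simp add: of_nat_diff)
    then show "[int (p - c * r) ^ N = int (c * r) ^ N] (mod int p)"
      using even_power_reflect_cong[OF \<open>even N\<close>, of "int p" "int (c * r)"] by simp
  qed
  have two: "(\<Sum>r=1..m. int (2 * r) ^ N) = 2 ^ N * A"
    by (simp add: A_def sum_distrib_left power_mult_distrib)
  have "[(\<Sum>r=1..<p. int r ^ N) = A + A] (mod int p)"
    unfolding sum_split_half[OF assms(2)] by (intro cong_add) (use refl[of 1] in \<open>simp_all add: A_def\<close>)
  moreover have "[(\<Sum>r=1..<p. int r ^ N) = 2 ^ N * A + 2 ^ N * A] (mod int p)"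
    unfolding sum_split_parity[OF assms(2)] using refl[of 2] unfolding two by (intro cong_add cong_refl) simp_all
  ultimately have "[A + A = 2 ^ N * A + 2 ^ N * A] (mod int p)"
    using cong_sym cong_trans by blast
  then have "[2 * (A + A) = 2 * (2 ^ N * A + 2 ^ N * A)] (mod int p)" by (rule cong_scalar_left)
  then have "[4 * A = (4 * 2 ^ N) * A] (mod int p)" by (simp add: algebra_simps)
  also have "[(4 * 2 ^ N) * A = 1 * A] (mod int p)"
    unfolding N_def by (intro cong_mult four_two_power_cong cong_refl assms)
  finally have "int p dvd 3 * A" by (simp add: cong_iff_dvd_diff)
  moreover have "\<not> p dvd 3" using assms by (auto dest: dvd_imp_le)
  then have "\<not> int p dvd 3" by (metis int_dvd_int_iff of_nat_numeral)
  ultimately have "int p dvd A" using assms(1) by (metis prime_dvd_mult_iff prime_nat_int_transfer)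
  then show ?thesis by (simp add: A_def N_def cong_0_iff)
qed

section \<open>Products of the integers prime to p\<close>

definition unit_block :: "nat \<Rightarrow> int \<Rightarrow> int" where
  "unit_block p j = (\<Prod>r=1..<p. int p * j + int r)"

text \<open>This is R(m) of the overview.\<close>

definition unit_fact :: "nat \<Rightarrow> nat \<Rightarrow> int" where
  "unit_fact p m = (\<Prod>j<m. unit_block p (int j))"

lemma unit_fact_0 [simp]: "unit_fact p 0 = 1"
  by (simp add: unit_fact_def)

lemma unit_fact_Suc: "unit_fact p (Suc m) = unit_fact p m * unit_block p (int m)"
  by (simp add: unit_fact_def)

lemma fact_add_prod: "fact (n + k) = (fact n * (\<Prod>i=1..k. int n + int i) :: int)"
  by (induction k) (simp_all add: algebra_simps)

text \<open>The multiples of \<open>p\<close> among the factors of (pm)! contribute p^m m!.\<close>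

lemma fact_mult_unit_fact:
  assumes "p > 0"
  shows "fact (p * m) = int p ^ m * fact m * unit_fact p m"
proof (induction m)
  case (Suc m)
  have "{1..p} = insert p {1..<p}" using assms by auto
  then have "(\<Prod>i=1..p. int (p * m) + int i) = int p * (int m + 1) * unit_block p (int m)"
    by (simp add: unit_block_def algebra_simps)
  moreover have "fact (p * Suc m) = fact (p * m) * (\<Prod>i=1..p. int (p * m) + int i)"
    using fact_add_prod[of "p * m" p] by (simp add: add.commute)
  ultimately have "fact (p * Suc m) = int p ^ m * fact m * unit_fact p m * (int p * (int m + 1) * unit_block p (int m))"
    by (simp only: Suc)
  then show ?case by (simp add: unit_fact_Suc)
qed simp

lemma binomial_fact_int: "fact a * fact b * int ((a + b) choose a) = fact (a + b)"
proof -
  have "fact a * fact b * ((a + b) choose a) = (fact (a + b) :: nat)"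
    using binomial_fact_lemma[of a "a + b"] by simp
  from arg_cong[OF this, of int] show ?thesis by simp
qed

text \<open>The quotient formula for C(p(a+b), pa), multiplied out to stay in the integers; the
  powers of \<open>p\<close> in the factorials cancel because the exponents add up.\<close>

lemma binomial_mult_unit_fact:
  assumes "p > 0"
  shows "int ((p * (a + b)) choose (p * a)) * (unit_fact p a * unit_fact p b) =
    int ((a + b) choose a) * unit_fact p (a + b)"
proof -
  let ?c = "int p ^ (a + b) * (fact a * fact b)"
  have "?c * (int ((p * (a + b)) choose (p * a)) * (unit_fact p a * unit_fact p b)) =
      fact (p * a) * fact (p * b) * int ((p * a + p * b) choose (p * a))"
    unfolding fact_mult_unit_fact[OF assms] by (simp add: power_add distrib_left)
  also have "\<dots> = fact (p * (a + b))"
    by (simp add: binomial_fact_int distrib_left)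
  also have "\<dots> = int p ^ (a + b) * fact (a + b) * unit_fact p (a + b)"
    using assms by (rule fact_mult_unit_fact)
  also have "\<dots> = ?c * (int ((a + b) choose a) * unit_fact p (a + b))"
    by (simp flip: binomial_fact_int)
  finally show ?thesis using assms by simp
qed

lemma coprime_unit_block:
  assumes "prime p"
  shows "coprime (unit_block p j) (int p)"
  unfolding unit_block_def
proof (rule prod_coprime_left)
  fix r assume r: "r \<in> {1..<p}"
  then have "\<not> int p dvd int r" by (auto dest: dvd_imp_le)
  then have "\<not> int p dvd int p * j + int r" by (simp add: dvd_add_right_iff)
  then show "coprime (int p * j + int r) (int p)"
    using assms by (metis coprime_commute prime_imp_coprime prime_nat_int_transfer)
qed

lemma coprime_unit_fact: "prime p \<Longrightarrow> coprime (unit_fact p m) (int p)"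
  unfolding unit_fact_def by (intro prod_coprime_left coprime_unit_block)

lemma unit_block_half:
  assumes "p = 2 * m + 1"
  shows "unit_block p j = (\<Prod>r=1..m. int r * (int p - int r) + int p ^ 2 * (j * (j + 1)))"
  unfolding unit_block_def prod_split_half[OF assms]
proof (rule prod.cong)
  fix r assume "r \<in> {1..m}"
  then have "int (p - r) = int p - int r" using assms by (simp add: of_nat_diff)
  then show "(int p * j + int r) * (int p * j + int (p - r)) = int r * (int p - int r) + int p ^ 2 * (j * (j + 1))"
    by (simp add: algebra_simps power2_eq_square)
qed simp

text \<open>First-order expansion of the product in its shift. As \<open>v r\<close> inverts
  \<open>u r\<close> modulo \<open>q\<close>, the divided difference \<open>d\<close> reduces to the
  derivative at 0, the product times the sum of inverses. The factor \<open>X - Y\<close> is kept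
  exact because its own divisibility is needed later.\<close>

lemma prod_shift_diff:
  fixes u v :: "'a \<Rightarrow> int"
  assumes "finite A" "q dvd X" "q dvd Y" "\<And>r. r \<in> A \<Longrightarrow> [u r * v r = 1] (mod q)"
  shows "\<exists>d. (\<Prod>r\<in>A. u r + X) - (\<Prod>r\<in>A. u r + Y) = (X - Y) * d \<and>
    [d = (\<Prod>r\<in>A. u r) * (\<Sum>r\<in>A. v r)] (mod q)"
  using assms(1,4)
proof (induction A rule: finite_induct)
  case empty
  show ?case by (intro exI[of _ 0]) simp
next
  case (insert r A)
  then obtain d where d: "(\<Prod>r\<in>A. u r + X) - (\<Prod>r\<in>A. u r + Y) = (X - Y) * d"
    "[d = (\<Prod>r\<in>A. u r) * (\<Sum>r\<in>A. v r)] (mod q)" by auto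
  let ?PX = "\<Prod>r\<in>A. u r + X" and ?PY = "\<Prod>r\<in>A. u r + Y" and ?U = "\<Prod>r\<in>A. u r" and ?V = "\<Sum>r\<in>A. v r"
  have "[?PX = (\<Prod>r\<in>A. u r + 0)] (mod q)"
    using assms(2) by (intro cong_prod cong_add cong_refl) (simp add: cong_0_iff)
  then have PX: "[?PX = ?U] (mod q)" by simp
  have Y: "[Y = 0] (mod q)" using assms(3) by (simp add: cong_0_iff)
  have "(u r + X) * ?PX - (u r + Y) * ?PY = (u r + Y) * (?PX - ?PY) + (X - Y) * ?PX"
    by (simp add: algebra_simps)
  also have "\<dots> = (X - Y) * (u r * d + ?PX + Y * d)"
    unfolding d(1) by (simp add: algebra_simps)
  finally have 1: "(u r + X) * ?PX - (u r + Y) * ?PY = (X - Y) * (u r * d + ?PX + Y * d)" .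
  have "[u r * d + ?PX + Y * d = u r * (?U * ?V) + 1 * ?U + 0 * d] (mod q)"
    by (intro cong_add cong_mult cong_refl d(2) Y) (simp add: PX)
  also have "[u r * (?U * ?V) + 1 * ?U + 0 * d = u r * (?U * ?V) + (u r * v r) * ?U + 0 * d] (mod q)"
    using insert.prems[of r] by (intro cong_add cong_mult cong_refl) (simp_all add: cong_sym_eq)
  also have "u r * (?U * ?V) + (u r * v r) * ?U + 0 * d = u r * ?U * (v r + ?V)"
    by (simp add: algebra_simps)
  finally show ?case
    using 1 insert.hyps by (intro exI[of _ "u r * d + ?PX + Y * d"]) simp
qed

text \<open>The shift \<open>X - Y\<close> supplies p^2 h, and the derivative supplies the third
  \<open>p\<close>: it contains the sum of 1/(r(p-r)), which is minus the half sum of r^(p-3), and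
  that vanishes modulo \<open>p\<close>.\<close>

lemma unit_block_shift:
  fixes p m :: nat and h j :: int
  assumes "prime p" "p = 2 * m + 1" "m > 1"
  shows "int p ^ 3 * h dvd unit_block p (h + j) - unit_block p j"
proof -
  define N where "N = 2 * (m - 1)"
  define X where "X = int p ^ 2 * ((h + j) * (h + j + 1))"
  define Y where "Y = int p ^ 2 * (j * (j + 1))"
  \<comment> \<open>Modulo \<open>p\<close>, \<open>?u r\<close> is -r^2, so Fermat gives the
    inverse -r^(p-3).\<close>
  let ?u = "\<lambda>r. int r * (int p - int r)" and ?v = "\<lambda>r. - (int r ^ N)"
  have "\<exists>d. (\<Prod>r=1..m. ?u r + X) - (\<Prod>r=1..m. ?u r + Y) = (X - Y) * d \<and>
    [d = (\<Prod>r=1..m. ?u r) * (\<Sum>r=1..m. ?v r)] (mod int p)"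
  proof (rule prod_shift_diff)
    fix r assume r: "r \<in> {1..m}"
    then have "\<not> p dvd r" using assms(2) by (auto dest: dvd_imp_le)
    then have "\<not> int p dvd int r" by simp
    then have f: "[int r ^ (p - 1) = 1] (mod int p)" by (rule fermat_int[OF assms(1)])
    have e: "int r ^ (p - 1) = int r ^ (N + 2)"
      by (rule arg_cong[where f = "\<lambda>k. int r ^ k"]) (use assms N_def in simp)
    have "?u r * ?v r = int r ^ (p - 1) + int p * (- (int r ^ Suc N))"
      unfolding e by (simp add: algebra_simps power2_eq_square)
    also have "[\<dots> = 1 + 0] (mod int p)"
      by (intro cong_add f) (simp add: cong_0_iff)
    finally show "[?u r * ?v r = 1] (mod int p)" by simp
  qed (simp_all add: X_def Y_def)
  then obtain d where d: "unit_block p (h + j) - unit_block p j = (X - Y) * d"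
    "[d = (\<Prod>r=1..m. ?u r) * (\<Sum>r=1..m. ?v r)] (mod int p)"
    unfolding unit_block_half[OF assms(2)] X_def Y_def by auto
  have "[(\<Sum>r=1..m. ?v r) = - 0] (mod int p)"
    unfolding sum_negf N_def cong_minus_minus_iff by (rule half_power_sum_cong_0[OF assms])
  then have "[(\<Prod>r=1..m. ?u r) * (\<Sum>r=1..m. ?v r) = (\<Prod>r=1..m. ?u r) * - 0] (mod int p)"
    by (rule cong_scalar_left)
  with d(2) have "int p dvd d" by (simp add: cong_dvd_iff cong_0_iff)
  moreover have "X - Y = int p ^ 2 * h * (h + 2 * j + 1)"
    by (simp add: X_def Y_def algebra_simps)
  ultimately have "int p ^ 2 * h * int p dvd (X - Y) * d" by (intro mult_dvd_mono) auto
  then show ?thesis by (simp add: d(1) power3_eq_cube power2_eq_square algebra_simps)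
qed

text \<open>
  The correction \<open>D\<close> allows \<open>p = 3\<close> to be treated together with \<open>p > 3\<close>, where \<open>D = 0\<close>.
\<close>

locale block_expansion =
  fixes p :: nat and D :: int
  assumes prime_p: "prime p" and D_dvd: "int p ^ 2 dvd D"
    and block: "\<And>h j. int p ^ 3 * h dvd unit_block p (h + j) - unit_block p j * (1 + D * (h * (h + 2 * j + 1)))"
begin

lemma p_pos: "p > 0"
  using prime_p prime_gt_0_nat by blast

text \<open>Induction on \<open>b\<close>: comparing block a + b with block b adds a(a + 2b + 1) to
  the correction, exactly the increment of ab(a + b) in b. The cross term carries D^2, which p^4
  divides.\<close>

lemma unit_fact_add:
  "int p ^ 3 * int a dvd unit_fact p (a + b) - unit_fact p a * unit_fact p b * (1 + D * (int a * int b * (int a + int b)))"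
proof (induction b)
  case (Suc b)
  let ?q = "int p ^ 3 * int a"
  let ?x = "int a * int b * (int a + int b)" and ?y = "int a * (int a + 2 * int b + 1)"
  have "int p ^ 3 * int a dvd (D * D) * (int a * (int b * (int a + int b) * ?y))"
  proof (rule mult_dvd_mono)
    have "int p ^ 3 dvd int p ^ 2 * int p ^ 2" by (simp flip: power_add add: le_imp_power_dvd)
    also have "\<dots> dvd D * D" by (intro mult_dvd_mono D_dvd)
    finally show "int p ^ 3 dvd D * D" .
  qed simp
  then have DD: "[(1 + D * ?x) * (1 + D * ?y) = 1 + D * (?x + ?y)] (mod ?q)"
    by (simp add: cong_iff_dvd_diff algebra_simps)
  have "[unit_fact p (a + b) = unit_fact p a * unit_fact p b * (1 + D * ?x)] (mod ?q)"
    using Suc by (simp add: cong_iff_dvd_diff)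
  moreover have "[unit_block p (int a + int b) = unit_block p (int b) * (1 + D * ?y)] (mod ?q)"
    using block[of "int a" "int b"] by (simp add: cong_iff_dvd_diff)
  ultimately have "[unit_fact p (a + b) * unit_block p (int a + int b) =
      (unit_fact p a * unit_fact p b * (1 + D * ?x)) * (unit_block p (int b) * (1 + D * ?y))] (mod ?q)"
    by (rule cong_mult)
  also have "(unit_fact p a * unit_fact p b * (1 + D * ?x)) * (unit_block p (int b) * (1 + D * ?y)) =
      (unit_fact p a * unit_fact p (Suc b)) * ((1 + D * ?x) * (1 + D * ?y))"
    by (simp add: unit_fact_Suc)
  also have "[\<dots> = (unit_fact p a * unit_fact p (Suc b)) * (1 + D * (?x + ?y))] (mod ?q)"
    by (intro cong_mult cong_refl DD)
  also have "?x + ?y = int a * int (Suc b) * (int a + int (Suc b))"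
    by (simp add: algebra_simps)
  finally show ?case by (simp add: unit_fact_Suc cong_iff_dvd_diff)
qed simp

end

lemma block_expansion_gt_3:
  assumes "prime p" "p > 3"
  shows "block_expansion p 0"
proof
  fix h j
  have "odd p" using assms prime_odd_nat by auto
  then obtain m where "p = 2 * m + 1" by (elim oddE)
  then show "int p ^ 3 * h dvd unit_block p (h + j) - unit_block p j * (1 + 0 * (h * (h + 2 * j + 1)))"
    using unit_block_shift[of p m h j] assms by simp
qed (use assms in simp_all)

text \<open>The block is 2 + 9j(j+1), so modulo 27 the correction has to satisfy 2D = 9, as -9
  does.\<close>

lemma block_expansion_3: "block_expansion 3 (-9)"
proof
  fix h j :: int
  have b: "unit_block 3 j = 2 + 9 * (j * (j + 1))" for j
    using unit_block_half[of 3 1 j] by simp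
  have "unit_block 3 (h + j) - unit_block 3 j * (1 + - 9 * (h * (h + 2 * j + 1))) =
    27 * h * ((h + 2 * j + 1) * (1 + 3 * (j * (j + 1))))"
    unfolding b by (simp add: algebra_simps)
  then show "int 3 ^ 3 * h dvd unit_block 3 (h + j) - unit_block 3 j * (1 + - 9 * (h * (h + 2 * j + 1)))"
    by simp
qed simp_all

section \<open>Binomial coefficients modulo powers of p\<close>

text \<open>The absorption identity a C(a+b, a) = (a+b) C(a+b-1, a-1).\<close>

lemma add_dvd_mult_binomial: "int (a + b) dvd int ((a + b) choose a) * int a"
proof (cases a)
  case (Suc a')
  have "((a + b) choose a) * a = (a + b) * ((a' + b) choose a')"
    using Suc_times_binomial_eq[of "a' + b" a'] Suc by simp
  then show ?thesis by (metis dvd_triv_left of_nat_mult)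
qed simp

text \<open>The three factors are the corrections of C(n,a), C(2a,a) and C(2b,b) for n = a + b.
  Their linear part is rewritten through n, and the remainder is displayed with a factor
  \<open>x\<close> so that absorption applies to it.\<close>

lemma triple_product_expansion:
  fixes D x y :: int
  shows "(1 + D * (x * y * (x + y))) * (1 + D * (x * x * (x + x))) * (1 + D * (y * y * (y + y))) -
    (1 + D * (2 * (x + y) ^ 3 - 5 * (x + y) * x * y)) =
    D ^ 2 * x * (y * (x + y) * (2 * x ^ 3 + 2 * y ^ 3) + 4 * x ^ 2 * y ^ 3 + D * (4 * x ^ 3 * y ^ 4 * (x + y)))"
  by (simp add: algebra_simps power2_eq_square power3_eq_cube power4_eq_xxxx)

context block_expansion
begin

lemma coprime_power_unit_fact: "coprime (unit_fact p a * unit_fact p b) (int p ^ k)"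
  using coprime_unit_fact[OF prime_p] by simp

text \<open>The multiplier \<open>c\<close> turns the modulus p^3 a of \<open>unit_fact_add\<close>
  into p^(3+e). It lets a central coefficient borrow divisibility from C(n,a), which it lacks by
  itself.\<close>

lemma binomial_mult_cong:
  assumes "int p ^ e dvd c * int ((a + b) choose a) * int a"
  shows "[c * int ((p * (a + b)) choose (p * a)) =
    c * int ((a + b) choose a) * (1 + D * (int a * int b * (int a + int b)))] (mod int p ^ (3 + e))"
proof -
  let ?W = "unit_fact p a * unit_fact p b" and ?C = "int ((a + b) choose a)"
  let ?z = "1 + D * (int a * int b * (int a + int b))"
  have "c * int ((p * (a + b)) choose (p * a)) * ?W - c * ?C * ?z * ?W = c * ?C * (unit_fact p (a + b) - ?W * ?z)"
    using binomial_mult_unit_fact[OF p_pos, of a b] by (simp add: algebra_simps)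
  moreover have "int p ^ 3 * int p ^ e dvd c * ?C * (unit_fact p (a + b) - ?W * ?z)"
  proof -
    have "int p ^ 3 * int p ^ e dvd int p ^ 3 * (c * ?C * int a)" using assms by (intro mult_dvd_mono) auto
    also have "\<dots> = c * ?C * (int p ^ 3 * int a)" by simp
    also have "\<dots> dvd c * ?C * (unit_fact p (a + b) - ?W * ?z)"
      by (intro mult_dvd_mono unit_fact_add dvd_refl)
    finally show ?thesis .
  qed
  ultimately have "[c * int ((p * (a + b)) choose (p * a)) * ?W = c * ?C * ?z * ?W] (mod int p ^ (3 + e))"
    by (simp add: cong_iff_dvd_diff power_add)
  then show ?thesis using coprime_power_unit_fact cong_mult_rcancel by blast
qed

lemma multiple_term_cong:
  assumes "int p ^ e dvd int (a + b)"
  defines "c \<equiv> int ((a + b) choose a) * int ((2 * a) choose a) * int ((2 * b) choose b)"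
  shows "[int ((p * (a + b)) choose (p * a)) * int ((2 * (p * a)) choose (p * a)) * int ((2 * (p * b)) choose (p * b)) =
    c * (1 + D * (2 * int (a + b) ^ 3 - 5 * int (a + b) * int a * int b))] (mod int p ^ (3 + e))"
proof -
  let ?C = "int ((a + b) choose a)" and ?q = "int p ^ (3 + e)"
  let ?A = "int ((2 * a) choose a)" and ?B = "int ((2 * b) choose b)"
  let ?x = "1 + D * (int a * int b * (int a + int b))"
  let ?y = "\<lambda>a. 1 + D * (int a * int a * (int a + int a))"
  have da: "int p ^ e dvd ?C * int a"
    using assms(1) add_dvd_mult_binomial dvd_trans by blast
  have db: "int p ^ e dvd ?C * int b"
    using assms(1) add_dvd_mult_binomial[of b a] binomial_symmetric[of a "a + b"]
    by (metis add.commute add_diff_cancel_left' dvd_trans le_add1)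
  have 1: "[1 * int ((p * (a + b)) choose (p * a)) = 1 * ?C * ?x] (mod ?q)"
    using da by (intro binomial_mult_cong) simp
  have 2: "[?C * int ((p * (a + a)) choose (p * a)) = ?C * int ((a + a) choose a) * ?y a] (mod ?q)"
    using dvd_mult2[OF da, of "int ((a + a) choose a)"] by (intro binomial_mult_cong) (simp add: mult_ac)
  have 3: "[?C * int ((p * (b + b)) choose (p * b)) = ?C * int ((b + b) choose b) * ?y b] (mod ?q)"
    using dvd_mult2[OF db, of "int ((b + b) choose b)"] by (intro binomial_mult_cong) (simp add: mult_ac)
  have two: "p * (2 * a) = 2 * (p * a)" "a + a = 2 * a" for a by simp_all
  let ?PA = "int ((2 * (p * a)) choose (p * a))" and ?PB = "int ((2 * (p * b)) choose (p * b))"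
  have 2: "[?C * ?PA = ?C * ?A * ?y a] (mod ?q)" and 3: "[?C * ?PB = ?C * ?B * ?y b] (mod ?q)"
    using 2 3 by (simp_all only: two of_nat_add)
  \<comment> \<open>This binomial is replaced first, since it provides the factor \<open>?C\<close>
    that the congruences for both central coefficients require.\<close>
  have "[int ((p * (a + b)) choose (p * a)) * (?PA * ?PB) = ?C * ?x * (?PA * ?PB)] (mod ?q)"
    using cong_scalar_right[OF 1, of "?PA * ?PB"] by simp
  also have "?C * ?x * (?PA * ?PB) = (?C * ?PA) * (?x * ?PB)" by simp
  also have "[\<dots> = (?C * ?A * ?y a) * (?x * ?PB)] (mod ?q)" using 2 by (rule cong_scalar_right)
  also have "(?C * ?A * ?y a) * (?x * ?PB) = (?C * ?PB) * (?A * ?y a * ?x)" by simp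
  also have "[\<dots> = (?C * ?B * ?y b) * (?A * ?y a * ?x)] (mod ?q)" using 3 by (rule cong_scalar_right)
  also have "(?C * ?B * ?y b) * (?A * ?y a * ?x) = c * (?x * ?y a * ?y b)" by (simp add: c_def)
  also have "[\<dots> = c * (1 + D * (2 * int (a + b) ^ 3 - 5 * int (a + b) * int a * int b))] (mod ?q)"
  proof -
    have "(?x * ?y a * ?y b) - (1 + D * (2 * int (a + b) ^ 3 - 5 * int (a + b) * int a * int b)) =
      D ^ 2 * int a * (int b * (int a + int b) * (2 * int a ^ 3 + 2 * int b ^ 3) + 4 * int a ^ 2 * int b ^ 3
        + D * (4 * int a ^ 3 * int b ^ 4 * (int a + int b)))"
      using triple_product_expansion[of D "int a" "int b"] by simp
    then have "c * (?x * ?y a * ?y b) - c * (1 + D * (2 * int (a + b) ^ 3 - 5 * int (a + b) * int a * int b)) =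
      D ^ 2 * (?C * int a) * (?A * ?B * (int b * (int a + int b) * (2 * int a ^ 3 + 2 * int b ^ 3) + 4 * int a ^ 2 * int b ^ 3
        + D * (4 * int a ^ 3 * int b ^ 4 * (int a + int b))))" (is "_ = ?r")
      unfolding right_diff_distrib[symmetric] by (simp add: c_def)
    moreover have "int p ^ 3 * int p ^ e dvd ?r"
    proof (rule dvd_mult2, rule mult_dvd_mono)
      have "int p ^ 3 dvd (int p ^ 2) ^ 2" by (simp flip: power_mult add: le_imp_power_dvd)
      also have "\<dots> dvd D ^ 2" by (intro dvd_power_same D_dvd)
      finally show "int p ^ 3 dvd D ^ 2" .
    qed (rule da)
    ultimately show ?thesis by (simp add: cong_iff_dvd_diff power_add)
  qed
  finally show ?thesis by (simp add: mult.assoc)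
qed

lemma p_dvd_D: "[D = 0] (mod int p)"
  using D_dvd by (simp add: cong_0_iff power2_eq_square dvd_mult_left)

lemma central_binomial_mult_cong: "[int ((2 * (p * a)) choose (p * a)) = int ((2 * a) choose a)] (mod int p ^ 2)"
proof -
  have two: "p * (2 * a) = 2 * (p * a)" "a + a = 2 * a" by simp_all
  have "[1 * int ((p * (a + a)) choose (p * a)) = 1 * int ((a + a) choose a) *
    (1 + D * (int a * int a * (int a + int a)))] (mod int p ^ (3 + 0))"
    by (rule binomial_mult_cong) simp
  then have "[int ((2 * (p * a)) choose (p * a)) = int ((2 * a) choose a) *
    (1 + D * (int a * int a * (int a + int a)))] (mod int p ^ 3)"
    by (simp only: two mult_1 add_0_right)
  then have "[int ((2 * (p * a)) choose (p * a)) = int ((2 * a) choose a) *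
    (1 + D * (int a * int a * (int a + int a)))] (mod int p ^ 2)"
    by (rule cong_dvd_modulus) (simp add: le_imp_power_dvd)
  also have "[int ((2 * a) choose a) * (1 + D * (int a * int a * (int a + int a))) =
    int ((2 * a) choose a) * (1 + 0 * (int a * int a * (int a + int a)))] (mod int p ^ 2)"
    using D_dvd by (intro cong_add cong_mult cong_refl) (simp add: cong_0_iff)
  finally show ?thesis by simp
qed

text \<open>From (n-a) C(n,a) = n C(n-1,a), applied to (n,a) and to (pn,pa); the common factor pn
  and the units are cancelled.\<close>

lemma binomial_pred_mult_cong:
  assumes "a < n"
  shows "[int ((n * p - 1) choose (p * a)) = int ((n - 1) choose a)] (mod int p)"
proof -
  define b where "b = n - a"
  have n: "n = a + b" using assms by (simp add: b_def)
  let ?W = "unit_fact p a * unit_fact p b"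
  have 1: "b * (n choose a) = n * ((n - 1) choose a)"
    using binomial_absorb_comp[of n a] n by simp
  have "p * n - p * a = p * b" using n by (simp add: distrib_left)
  then have 2: "p * b * ((p * n) choose (p * a)) = p * n * ((p * n - 1) choose (p * a))"
    using binomial_absorb_comp[of "p * n" "p * a"] by simp
  have "int (p * n) * (int ((p * n - 1) choose (p * a)) * ?W) = int (p * b * ((p * n) choose (p * a))) * ?W"
    unfolding 2 by simp
  also have "\<dots> = int (p * b) * (int ((p * n) choose (p * a)) * ?W)" by simp
  also have "\<dots> = int p * int (b * (n choose a)) * unit_fact p n"
    using binomial_mult_unit_fact[OF p_pos, of a b] n by simp
  also have "\<dots> = int (p * n) * (int ((n - 1) choose a) * unit_fact p n)"
    unfolding 1 by simp
  finally have 3: "int ((n * p - 1) choose (p * a)) * ?W = int ((n - 1) choose a) * unit_fact p n"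
    using assms p_pos by (simp add: mult.commute)
  have "[unit_fact p n = ?W * (1 + D * (int a * int b * (int a + int b)))] (mod int p ^ 3 * int a)"
    using unit_fact_add[of a b] n by (simp add: cong_iff_dvd_diff)
  then have "[unit_fact p n = ?W * (1 + D * (int a * int b * (int a + int b)))] (mod int p)"
    by (rule cong_dvd_modulus) (simp add: power3_eq_cube)
  also have "[?W * (1 + D * (int a * int b * (int a + int b))) = ?W * (1 + 0 * (int a * int b * (int a + int b)))] (mod int p)"
    by (intro cong_mult cong_add cong_refl p_dvd_D)
  finally have "[unit_fact p n = ?W] (mod int p)" by simp
  from cong_scalar_left[OF this, of "int ((n - 1) choose a)"]
  have "[int ((n * p - 1) choose (p * a)) * ?W = int ((n - 1) choose a) * ?W] (mod int p)"
    unfolding 3 .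
  moreover have "coprime ?W (int p)" using coprime_power_unit_fact[of a b 1] by simp
  ultimately show ?thesis using cong_mult_rcancel by blast
qed

text \<open>In j C(np,j) = np C(np-1,j-1) the factor j is prime to \<open>p\<close>.\<close>

lemma dvd_binomial_nonmultiple:
  assumes "\<not> p dvd j" "int p ^ e dvd int n"
  shows "int p ^ (e + 1) dvd int ((n * p) choose j)"
proof -
  have "j > 0" using assms(1) by (cases j) auto
  then have "j * ((n * p) choose j) = (n * p) * ((n * p - 1) choose (j - 1))"
    by (rule times_binomial_minus1_eq)
  then have "int j * int ((n * p) choose j) = int n * int p * int ((n * p - 1) choose (j - 1))"
    by (metis of_nat_mult)
  moreover have "int p ^ e * int p dvd int n * int p" using assms(2) by (intro mult_dvd_mono) auto
  ultimately have "int p ^ (e + 1) dvd int j * int ((n * p) choose j)"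
    by (simp add: mult.commute)
  moreover have "coprime (int p ^ (e + 1)) (int j)"
    using assms(1) prime_p by (simp add: prime_imp_coprime)
  ultimately show ?thesis by (simp add: coprime_dvd_mult_right_iff)
qed

text \<open>By Pascal's rule neighbouring coefficients of row np - 1 add up to an entry C(np,j) with
  j prime to \<open>p\<close>, which vanishes modulo \<open>p\<close>; each step thus flips the
  sign.\<close>

lemma binomial_pred_cong:
  assumes "a < n" "r < p"
  shows "[int ((n * p - 1) choose (p * a + r)) = (-1) ^ r * int ((n - 1) choose a)] (mod int p)"
  using assms(2)
proof (induction r)
  case 0
  then show ?case using binomial_pred_mult_cong[OF assms(1)] by simp
next
  case (Suc r)
  have "\<not> p dvd Suc r" using Suc.prems by (auto dest: dvd_imp_le)
  then have "\<not> p dvd p * a + Suc r" by (metis dvd_add_right_iff dvd_triv_left)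
  then have "int p dvd int ((n * p) choose Suc (p * a + r))"
    using dvd_binomial_nonmultiple[of "p * a + Suc r" 0 n] by simp
  moreover have "n * p = Suc (n * p - 1)" using assms p_pos by simp
  then have "(n * p) choose Suc (p * a + r) = ((n * p - 1) choose (p * a + r)) + ((n * p - 1) choose Suc (p * a + r))"
    by (metis binomial_Suc_Suc)
  ultimately have "[int ((n * p - 1) choose Suc (p * a + r)) = - int ((n * p - 1) choose (p * a + r))] (mod int p)"
    by (simp add: cong_iff_dvd_diff add.commute flip: of_nat_add)
  also have "[- int ((n * p - 1) choose (p * a + r)) = - ((-1) ^ r * int ((n - 1) choose a))] (mod int p)"
    using Suc by (simp add: cong_minus_minus_iff)
  finally show ?case by simp
qed

text \<open>Absorption gives (pa+r) C(np,pa+r) = np C(np-1,pa+r-1). The part with pa on the left is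
  negligible, as p C(np,pa+r) is already divisible by p^(e+2).\<close>

lemma binomial_nonmultiple_cong:
  assumes "a < n" "0 < r" "r < p" "int p ^ e dvd int n"
  shows "[int r * int ((n * p) choose (p * a + r)) = (-1) ^ (r - 1) * (int n * int p * int ((n - 1) choose a))] (mod int p ^ (e + 2))"
proof -
  let ?C = "int ((n * p) choose (p * a + r))"
  have "\<not> p dvd r" using assms by (auto dest: dvd_imp_le)
  then have "\<not> p dvd p * a + r" by (metis dvd_add_right_iff dvd_triv_left)
  then have "int p * int p ^ (e + 1) dvd int p * ?C"
    using dvd_binomial_nonmultiple[OF _ assms(4)] by (intro mult_dvd_mono) auto
  then have 1: "[int p * ?C = 0] (mod int p ^ (e + 2))"
    by (simp add: cong_0_iff)
  have "(p * a + r) * ((n * p) choose (p * a + r)) = (n * p) * ((n * p - 1) choose (p * a + r - 1))"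
    using assms by (intro times_binomial_minus1_eq) simp
  moreover have "p * a + r - 1 = p * a + (r - 1)" using assms by simp
  ultimately have "int ((p * a + r) * ((n * p) choose (p * a + r))) = int (n * p * ((n * p - 1) choose (p * a + (r - 1))))"
    by simp
  then have 2: "int r * ?C = int n * int p * int ((n * p - 1) choose (p * a + (r - 1))) - int a * (int p * ?C)"
    by (simp add: algebra_simps)
  have "int p ^ e * int p * int p dvd int n * int p * (int ((n * p - 1) choose (p * a + (r - 1))) - (-1) ^ (r - 1) * int ((n - 1) choose a))"
    using binomial_pred_cong[OF assms(1), of "r - 1"] assms
    by (intro mult_dvd_mono) (auto simp: cong_iff_dvd_diff)
  then have "[int n * int p * int ((n * p - 1) choose (p * a + (r - 1))) = (-1) ^ (r - 1) * (int n * int p * int ((n - 1) choose a))] (mod int p ^ (e + 2))"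
    by (simp add: cong_iff_dvd_diff algebra_simps)
  from cong_diff[OF this cong_scalar_left[OF 1, of "int a"]] show ?thesis
    unfolding 2 by simp
qed

end

section \<open>Central binomial coefficients\<close>

lemma prod_shift_cong_fact: "[(\<Prod>i=1..k. int (p * c) + int i) = fact k] (mod int p)"
proof -
  have "[(\<Prod>i=1..k. int (p * c) + int i) = (\<Prod>i=1..k. 0 + int i)] (mod int p)"
    by (intro cong_prod cong_add cong_refl) (simp add: cong_0_iff)
  also have "(\<Prod>i=1..k. 0 + int i) = fact k" by (simp add: fact_prod)
  finally show ?thesis .
qed

lemma central_binomial_fact: "fact k * fact k * int ((2 * k) choose k) = fact (2 * k)"
  using binomial_fact_int[of k k] by (simp add: mult_2)

lemma central_binomial_shift:
  "int ((2 * (q + r)) choose (q + r)) * ((\<Prod>i=1..r. int q + int i) * (\<Prod>i=1..r. int q + int i)) =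
    int ((2 * q) choose q) * (\<Prod>i=1..2*r. int (2 * q) + int i)"
proof -
  let ?P = "\<Prod>i=1..r. int q + int i"
  have "(fact q * fact q) * (int ((2 * (q + r)) choose (q + r)) * (?P * ?P)) =
    fact (q + r) * fact (q + r) * int ((2 * (q + r)) choose (q + r))"
    unfolding fact_add_prod by simp
  also have "\<dots> = fact (2 * q + 2 * r)" unfolding central_binomial_fact by (simp add: distrib_left)
  also have "\<dots> = (fact q * fact q) * (int ((2 * q) choose q) * (\<Prod>i=1..2*r. int (2 * q) + int i))"
    unfolding fact_add_prod central_binomial_fact[symmetric] by simp
  finally show ?thesis by simp
qed

lemma coprime_fact_prime:
  assumes "prime p" "r < p"
  shows "coprime (fact r) (int p)"
  unfolding fact_prod of_nat_prod
proof (rule prod_coprime_left)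
  fix i assume "i \<in> {1..r}"
  then have "\<not> p dvd i" using assms(2) by (auto dest: dvd_imp_le)
  then show "coprime (int i) (int p)" using assms(1)
    by (metis coprime_commute coprime_int_iff prime_imp_coprime)
qed

text \<open>The prime divides (2s)! but not s!.\<close>

lemma prime_dvd_central_binomial:
  assumes "prime p" "s < p" "p \<le> 2 * s"
  shows "int p dvd int ((2 * s) choose s)"
proof -
  have "p dvd (fact (2 * s) :: nat)" using assms by (simp add: prime_dvd_fact_iff)
  then have "int p dvd fact (2 * s)" by (metis int_dvd_int_iff of_nat_fact)
  then have "int p dvd (fact s * fact s) * int ((2 * s) choose s)"
    unfolding central_binomial_fact .
  moreover have "coprime (int p) (fact s * fact s)"
    using coprime_fact_prime[OF assms(1,2)] by (simp add: coprime_commute)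
  ultimately show ?thesis using coprime_dvd_mult_right_iff by blast
qed

lemma central_binomial_Suc:
  "(int r + 1) * int ((2 * (r + 1)) choose (r + 1)) = 2 * (2 * int r + 1) * int ((2 * r) choose r)"
proof -
  define c where "c = int ((2 * (r + 1)) choose (r + 1))"
  have "fact (2 * (r + 1)) = 2 * (int r + 1) * (2 * int r + 1) * fact (2 * r)"
    by (simp add: algebra_simps)
  then have 1: "fact (r + 1) * fact (r + 1) * c = 2 * (int r + 1) * (2 * int r + 1) * (fact r * fact r * int ((2 * r) choose r))"
    unfolding central_binomial_fact c_def .
  have 2: "fact (r + 1) = (int r + 1) * fact r" by (simp add: algebra_simps)
  have "((int r + 1) * (fact r * fact r)) * ((int r + 1) * c) =
    ((int r + 1) * (fact r * fact r)) * (2 * (2 * int r + 1) * int ((2 * r) choose r))"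
    using 1 unfolding 2 by (simp only: mult_ac)
  moreover have "(int r + 1) * (fact r * fact r) \<noteq> 0" by simp
  ultimately show ?thesis unfolding c_def by (simp only: mult_cancel_left) blast
qed

text \<open>Since \<open>q\<close> divides \<open>w\<close> it divides \<open>z\<close> as well, so
  both parts of xz - yw = (x-y)z + y(z-w) gain the missing power.\<close>

lemma cong_mult_left_power:
  fixes q x y z w :: int
  assumes "[x = y] (mod q ^ (e + 2))" "q ^ (e + 1) dvd y" "[z = w] (mod q ^ 2)" "q dvd w"
  shows "[x * z = y * w] (mod q ^ (e + 3))"
proof -
  have "[z = w] (mod q)" using assms(3) by (rule cong_dvd_modulus) (simp add: power2_eq_square)
  then have "q dvd z" using assms(4) by (simp add: cong_dvd_iff)
  have "q ^ (e + 2) * q dvd (x - y) * z" "q ^ (e + 1) * q ^ 2 dvd y * (z - w)"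
    using assms \<open>q dvd z\<close> by (auto intro!: mult_dvd_mono simp: cong_iff_dvd_diff)
  then have "q ^ (e + 3) dvd (x - y) * z" "q ^ (e + 3) dvd y * (z - w)"
    by (simp_all add: power_add eval_nat_numeral mult_ac)
  then have "q ^ (e + 3) dvd (x - y) * z + y * (z - w)" by (rule dvd_add)
  then show ?thesis by (simp add: cong_iff_dvd_diff algebra_simps)
qed

lemma cong_mult_power2:
  fixes q x y z w :: int
  assumes "[x = y] (mod q)" "[z = w] (mod q ^ 2)" "q dvd w"
  shows "[x * z = y * w] (mod q ^ 2)"
proof -
  have "[z = w] (mod q)" using assms(2) by (rule cong_dvd_modulus) (simp add: power2_eq_square)
  then have "q dvd z" using assms(3) by (simp add: cong_dvd_iff)
  then have "q * q dvd (x - y) * z"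
    using assms(1) by (intro mult_dvd_mono) (auto simp: cong_iff_dvd_diff)
  moreover have "q ^ 2 dvd y * (z - w)" using assms(2) by (simp add: cong_iff_dvd_diff)
  ultimately have "q ^ 2 dvd (x - y) * z + y * (z - w)" by (simp add: power2_eq_square)
  then show ?thesis by (simp add: cong_iff_dvd_diff algebra_simps)
qed

context block_expansion
begin

lemma central_binomial_lucas:
  assumes "r < p"
  shows "[int ((2 * (p * a + r)) choose (p * a + r)) = int ((2 * a) choose a) * int ((2 * r) choose r)] (mod int p)"
proof -
  let ?P = "\<Prod>i=1..r. int (p * a) + int i" and ?C = "int ((2 * (p * a + r)) choose (p * a + r))"
  have P: "[?P = fact r] (mod int p)" by (rule prod_shift_cong_fact)
  have Q: "[(\<Prod>i=1..2*r. int (2 * (p * a)) + int i) = fact (2 * r)] (mod int p)"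
    using prod_shift_cong_fact[where c = "2 * a" and p = p] by (simp add: mult.left_commute)
  have A: "[int ((2 * (p * a)) choose (p * a)) = int ((2 * a) choose a)] (mod int p)"
    using central_binomial_mult_cong by (rule cong_dvd_modulus) (simp add: power2_eq_square)
  have "[?C * (fact r * fact r) = ?C * (?P * ?P)] (mod int p)"
    by (intro cong_mult cong_refl cong_sym[OF P])
  also have "?C * (?P * ?P) = int ((2 * (p * a)) choose (p * a)) * (\<Prod>i=1..2*r. int (2 * (p * a)) + int i)"
    by (rule central_binomial_shift)
  also have "[\<dots> = int ((2 * a) choose a) * fact (2 * r)] (mod int p)"
    by (intro cong_mult A Q)
  also have "int ((2 * a) choose a) * fact (2 * r) = int ((2 * a) choose a) * int ((2 * r) choose r) * (fact r * fact r)"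
    unfolding central_binomial_fact[symmetric] by simp
  finally show ?thesis
    using coprime_fact_prime[OF prime_p assms] by (subst (asm) cong_mult_rcancel) auto
qed

text \<open>Exactly one of the factors 2pb + i with 1 \<le> i \<le> 2s is divisible by
  \<open>p\<close>, namely i = p; it equals p(2b+1), the source of the weight 2b + 1. The remaining
  factors matter only modulo \<open>p\<close>.\<close>

lemma central_binomial_carry:
  assumes "s < p" "p \<le> 2 * s"
  shows "[int ((2 * (p * b + s)) choose (p * b + s)) =
    int ((2 * b) choose b) * (2 * int b + 1) * int ((2 * s) choose s)] (mod int p ^ 2)"
proof -
  let ?P = "\<Prod>i=1..s. int (p * b) + int i" and ?C = "int ((2 * (p * b + s)) choose (p * b + s))"
  let ?I = "{1..2*s} - {p}"
  let ?Q = "\<Prod>i\<in>?I. int (2 * (p * b)) + int i"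
  have I: "{1..2*s} = insert p ?I" using assms by auto
  have f: "fact (2 * s) = int p * (\<Prod>i\<in>?I. int i)"
  proof -
    have "fact (2 * s) = (\<Prod>i\<in>{1..2*s}. int i)" by (simp add: fact_prod)
    also have "\<dots> = int p * (\<Prod>i\<in>?I. int i)" by (subst I, subst prod.insert) auto
    finally show ?thesis .
  qed
  have g: "(\<Prod>i=1..2*s. int (2 * (p * b)) + int i) = (2 * int b + 1) * (int p * ?Q)"
    by (subst I, subst prod.insert) (auto simp: algebra_simps)
  have "[?Q = (\<Prod>i\<in>?I. 0 + int i)] (mod int p)"
    by (intro cong_prod cong_add cong_refl) (simp add: cong_0_iff)
  then have "int p * int p dvd int p * (?Q - (\<Prod>i\<in>?I. int i))"
    by (intro mult_dvd_mono) (auto simp: cong_iff_dvd_diff)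
  then have Q: "[int p * ?Q = fact (2 * s)] (mod int p ^ 2)"
    unfolding f by (simp add: cong_iff_dvd_diff algebra_simps power2_eq_square)
  have "[?C = int ((2 * b) choose b) * int ((2 * s) choose s)] (mod int p)"
    using assms(1) by (rule central_binomial_lucas)
  moreover have "int p dvd int ((2 * b) choose b) * int ((2 * s) choose s)"
    using prime_dvd_central_binomial[OF prime_p assms] by simp
  ultimately have C: "int p dvd ?C" using cong_dvd_iff by blast
  have "[?P * ?P = fact s * fact s] (mod int p)" by (intro cong_mult prod_shift_cong_fact)
  from cong_mult_power2[OF this cong_refl C]
  have "[?C * (fact s * fact s) = ?C * (?P * ?P)] (mod int p ^ 2)"
    by (simp add: cong_sym_eq mult.commute)
  also have "?C * (?P * ?P) = int ((2 * (p * b)) choose (p * b)) * ((2 * int b + 1) * (int p * ?Q))"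
    unfolding g[symmetric] by (rule central_binomial_shift)
  also have "[\<dots> = int ((2 * b) choose b) * ((2 * int b + 1) * fact (2 * s))] (mod int p ^ 2)"
    by (intro cong_mult cong_refl central_binomial_mult_cong Q)
  also have "int ((2 * b) choose b) * ((2 * int b + 1) * fact (2 * s)) =
      int ((2 * b) choose b) * (2 * int b + 1) * int ((2 * s) choose s) * (fact s * fact s)"
    unfolding central_binomial_fact[symmetric] by simp
  finally show ?thesis
    using coprime_fact_prime[OF prime_p assms(1)] by (subst (asm) cong_mult_rcancel) auto
qed

text \<open>Modulo p^2 the product does not depend on r: the recurrence of the central coefficients
  is used upwards at r and downwards at p - r. At r = 1 the value comes from C(2p,p) = 2 modulo
  p^2.\<close>

lemma central_binomial_reflection:
  assumes "p = 2 * m + 1" "1 \<le> r" "r \<le> m"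
  shows "[int r * int ((2 * r) choose r) * int ((2 * (p - r)) choose (p - r)) = - 2 * int p] (mod int p ^ 2)"
  using assms(2,3)
proof (induction r rule: dec_induct)
  case base
  let ?C = "int ((2 * (p - 1)) choose (p - 1))"
  have "int p * int ((2 * p) choose p) = 2 * (2 * (int p - 1) + 1) * ?C"
    using central_binomial_Suc[of "p - 1"] p_pos by (simp add: of_nat_diff)
  then have 1: "int p * int ((2 * p) choose p) = 4 * (int p * ?C) - 2 * ?C"
    by (simp add: algebra_simps)
  have "int p dvd ?C" using prime_dvd_central_binomial[OF prime_p, of "p - 1"] base assms(1) by simp
  then have 2: "[int p * ?C = 0] (mod int p ^ 2)" by (simp add: cong_0_iff power2_eq_square)
  have "[int p * int ((2 * p) choose p) = int p * 2] (mod int p ^ 2)"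
    using cong_scalar_left[OF central_binomial_mult_cong[of 1]] by simp
  from cong_diff[OF cong_scalar_left[OF 2, of 4] this[unfolded 1]]
  have "[2 * ?C = - 2 * int p] (mod int p ^ 2)" by (simp add: mult.commute)
  then show ?case by simp
next
  case (step r)
  define s where "s = p - Suc r"
  have s: "p - r = s + 1" using step assms(1) by (simp add: s_def)
  let ?Cr = "int ((2 * r) choose r)" and ?Cs = "int ((2 * s) choose s)"
  let ?Cr' = "int ((2 * Suc r) choose Suc r)" and ?Cs' = "int ((2 * (s + 1)) choose (s + 1))"
  have ps: "int p = int s + int r + 1" using s step assms(1) by simp
  have 1: "(int r + 1) * ?Cr' = 2 * (2 * int r + 1) * ?Cr"
    using central_binomial_Suc[of r] by (simp only: Suc_eq_plus1)
  have 2: "(int s + 1) * ?Cs' = 2 * (2 * int s + 1) * ?Cs"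
    by (rule central_binomial_Suc)
  have "int p dvd ?Cs" "int p dvd ?Cs'"
    using prime_dvd_central_binomial[OF prime_p, of s] prime_dvd_central_binomial[OF prime_p, of "s + 1"]
      step assms(1) by (simp_all add: s_def)
  then have 3: "[int p * ?Cs = 0] (mod int p ^ 2)" "[int p * ?Cs' = 0] (mod int p ^ 2)"
    by (simp_all add: cong_0_iff power2_eq_square)
  let ?X' = "(int r + 1) * ?Cr' * ?Cs" and ?X = "int r * ?Cr * ?Cs'"
  have "?X' * (2 * int s + 1) = (2 * int r + 1) * ?Cr * ((int s + 1) * ?Cs')"
    unfolding 1 2 by (simp add: algebra_simps)
  moreover have "int s = int p - int r - 1" using ps by simp
  \<comment> \<open>With s = p - r - 1 one has 2s + 1 = 2p - (2r+1) and s + 1 = p - r. The extra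
    terms pair \<open>p\<close> with a coefficient it divides, so they vanish modulo p^2.\<close>
  ultimately have 4: "(2 * int r + 1) * ?X' - 2 * (int r + 1) * ?Cr' * (int p * ?Cs) =
      (2 * int r + 1) * ?X - (2 * int r + 1) * ?Cr * (int p * ?Cs')"
    by (simp add: algebra_simps)
  have "[(2 * int r + 1) * ?X' - 2 * (int r + 1) * ?Cr' * (int p * ?Cs) = (2 * int r + 1) * ?X' - 2 * (int r + 1) * ?Cr' * 0] (mod int p ^ 2)"
    by (intro cong_diff cong_mult cong_refl 3)
  moreover have "[(2 * int r + 1) * ?X - (2 * int r + 1) * ?Cr * (int p * ?Cs') = (2 * int r + 1) * ?X - (2 * int r + 1) * ?Cr * 0] (mod int p ^ 2)"
    by (intro cong_diff cong_mult cong_refl 3)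
  ultimately have "[(2 * int r + 1) * ?X' = (2 * int r + 1) * ?X] (mod int p ^ 2)"
    unfolding 4 by (simp add: cong_def)
  moreover have "coprime (2 * int r + 1) (int p ^ 2)"
  proof -
    have "\<not> p dvd 2 * r + 1" using step assms(1) by (auto dest: dvd_imp_le)
    then have "coprime (int (2 * r + 1)) (int p)"
      using prime_p by (metis coprime_commute coprime_int_iff prime_imp_coprime)
    then show ?thesis by (simp add: add.commute)
  qed
  ultimately have "[?X' = ?X] (mod int p ^ 2)" using cong_mult_lcancel by blast
  moreover have "[?X = - 2 * int p] (mod int p ^ 2)" using step s by simp
  ultimately have "[?X' = - 2 * int p] (mod int p ^ 2)" by (rule cong_trans)
  then show ?case by (simp add: s_def add.commute)
qed

end

section \<open>The terms of S (n p)\<close>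

definition S_term :: "nat \<Rightarrow> nat \<Rightarrow> int" where
  "S_term n k = int (n choose k) * int ((2 * k) choose k) * int ((2 * (n - k)) choose (n - k))"

lemma S_eq_sum_S_term: "S n = (\<Sum>k\<le>n. S_term n k)"
  by (simp add: S_def S_term_def diff_mult_distrib2)

lemma S_term_reflect: "k \<le> n \<Longrightarrow> S_term n (n - k) = S_term n k"
  by (simp add: S_term_def binomial_symmetric[of k n])

text \<open>Under a -> n-1-a the summands \<open>S_term (n - 1) a\<close> are invariant, while the
  weights 2(n-1-a) + 1 and 2a + 1 average to n.\<close>

lemma S_sum_weighted: "(\<Sum>a<n. S_term (n - 1) a * (2 * int (n - 1 - a) + 1)) = int n * S (n - 1)"
proof (cases n)
  case (Suc N)
  let ?W = "\<Sum>a\<le>N. S_term N a * (2 * int (N - a) + 1)"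
  have "?W = (\<Sum>a\<le>N. S_term N (N - a) * (2 * int (N - (N - a)) + 1))"
    by (rule sum.reindex_bij_witness[of _ "\<lambda>a. N - a" "\<lambda>a. N - a"]) auto
  also have "\<dots> = (\<Sum>a\<le>N. S_term N a * (2 * int a + 1))"
    by (rule sum.cong) (auto simp: S_term_reflect)
  finally have "?W + ?W = (\<Sum>a\<le>N. S_term N a * (2 * int a + 1) + S_term N a * (2 * int (N - a) + 1))"
    by (simp add: sum.distrib)
  also have "\<dots> = (\<Sum>a\<le>N. 2 * (int n * S_term N a))"
    by (rule sum.cong) (auto simp: Suc of_nat_diff algebra_simps)
  also have "\<dots> = 2 * (int n * S N)"
    by (simp add: S_eq_sum_S_term sum_distrib_left)
  finally show ?thesis by (simp add: Suc lessThan_Suc_atMost)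
qed simp

lemma sum_split_multiples:
  fixes f :: "nat \<Rightarrow> 'a::comm_monoid_add"
  assumes "p > 0"
  shows "(\<Sum>k\<le>n * p. f k) = (\<Sum>a\<le>n. f (p * a)) + (\<Sum>a<n. \<Sum>r=1..<p. f (p * a + r))"
proof (induction n)
  case (Suc n)
  have "(\<Sum>k\<le>n * p + l. f k) = (\<Sum>k\<le>n * p. f k) + (\<Sum>r=1..l. f (p * n + r))" for l
    by (induction l) (simp_all add: ac_simps)
  from this[of p] have "(\<Sum>k\<le>Suc n * p. f k) = (\<Sum>k\<le>n * p. f k) + (\<Sum>r=1..p. f (p * n + r))"
    by (simp add: add.commute)
  moreover have "{1..p} = insert p {1..<p}" using assms by auto
  ultimately show ?case by (simp add: Suc ac_simps)
qed simp

text \<open>The reflection k -> np - k exchanges the residues r and p - r.\<close>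

lemma sum_nonmultiples_half:
  assumes "p = 2 * m + 1"
  shows "(\<Sum>a<n. \<Sum>r=1..<p. S_term (n * p) (p * a + r)) = 2 * (\<Sum>a<n. \<Sum>r=1..m. S_term (n * p) (p * a + r))"
proof -
  have "(\<Sum>a<n. \<Sum>r=1..m. S_term (n * p) (p * a + (p - r))) = (\<Sum>a<n. \<Sum>r=1..m. S_term (n * p) (p * (n - Suc a) + r))"
  proof (intro sum.cong refl)
    fix a r assume ar: "a \<in> {..<n}" "r \<in> {1..m}"
    obtain c where n: "n = Suc (a + c)" using ar(1) less_iff_Suc_add by auto
    obtain s where p: "p = r + s" using ar(2) assms by (auto intro: that[of "p - r"])
    have "n * p = (p * a + s) + (p * c + r)" unfolding n by (simp add: p algebra_simps)
    then have "p * a + (p - r) \<le> n * p" "p * (n - Suc a) + r = n * p - (p * a + (p - r))"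
      by (simp_all add: n p)
    then show "S_term (n * p) (p * a + (p - r)) = S_term (n * p) (p * (n - Suc a) + r)"
      by (simp add: S_term_reflect)
  qed
  also have "\<dots> = (\<Sum>a<n. \<Sum>r=1..m. S_term (n * p) (p * a + r))"
    by (rule sum.nat_diff_reindex)
  finally show ?thesis
    by (simp only: sum_split_half[OF assms] sum.distrib mult_2)
qed

context block_expansion
begin

text \<open>For k = pa + r the complement is np - k = pb + s with s > p/2, so only the second
  central coefficient has a carry. One factor r is needed for C(np,k) and one for the central pair;
  the resulting r^2 is inverted at the end.\<close>

lemma nonmultiple_term_cong:
  assumes "p = 2 * m + 1" "1 \<le> r" "r \<le> m" "a < n" "int p ^ e dvd int n"
  shows "[S_term (n * p) (p * a + r) = 2 * int n * int p ^ 2 * ((-1) ^ r * int r ^ (2 * (m - 1))) *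
    (S_term (n - 1) a * (2 * int (n - 1 - a) + 1))] (mod int p ^ (e + 3))"
proof -
  define b where "b = n - 1 - a"
  define s where "s = p - r"
  let ?q = "int p ^ (e + 3)"
  let ?C = "int ((n * p) choose (p * a + r))" and ?A = "int ((2 * (p * a + r)) choose (p * a + r))"
    and ?B = "int ((2 * (p * b + s)) choose (p * b + s))"
  let ?c = "int ((n - 1) choose a)" and ?ca = "int ((2 * a) choose a)" and ?cb = "int ((2 * b) choose b)"
    and ?cr = "int ((2 * r) choose r)" and ?cs = "int ((2 * s) choose s)"
  have n: "n = a + b + 1" using assms(4) by (simp add: b_def)
  have rs: "r < p" "s < p" "p \<le> 2 * s" "p = r + s" using assms by (auto simp: s_def)
  have "n * p - (p * a + r) = p * b + s"
    unfolding n using rs(4) by (simp add: algebra_simps)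
  then have t: "S_term (n * p) (p * a + r) = ?C * (?A * ?B)"
    by (simp add: S_term_def)
  have A: "[?A = ?ca * ?cr] (mod int p)" using rs(1) by (rule central_binomial_lucas)
  have B: "[?B = ?cb * (2 * int b + 1) * ?cs] (mod int p ^ 2)" using rs(2,3) by (rule central_binomial_carry)
  have "int p dvd ?cb * (2 * int b + 1) * ?cs"
    using prime_dvd_central_binomial[OF prime_p rs(2,3)] by simp
  from cong_mult_power2[OF A B this]
  have "[int r * (?A * ?B) = int r * ((?ca * ?cr) * (?cb * (2 * int b + 1) * ?cs))] (mod int p ^ 2)"
    by (rule cong_scalar_left)
  also have "int r * ((?ca * ?cr) * (?cb * (2 * int b + 1) * ?cs)) = ?ca * ?cb * (2 * int b + 1) * (int r * ?cr * ?cs)"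
    by simp
  also have "[\<dots> = ?ca * ?cb * (2 * int b + 1) * (- 2 * int p)] (mod int p ^ 2)"
    using central_binomial_reflection[OF assms(1-3)] unfolding s_def[symmetric] by (rule cong_scalar_left)
  finally have AB: "[int r * (?A * ?B) = ?ca * ?cb * (2 * int b + 1) * (- 2 * int p)] (mod int p ^ 2)" .
  have C: "[int r * ?C = (-1) ^ (r - 1) * (int n * int p * ?c)] (mod int p ^ (e + 2))"
    using assms rs by (intro binomial_nonmultiple_cong) auto
  have d1: "int p ^ (e + 1) dvd (-1) ^ (r - 1) * (int n * int p * ?c)"
  proof -
    have "int p ^ e * int p dvd int n * int p" using assms(5) by (intro mult_dvd_mono) auto
    then show ?thesis by (simp add: mult.commute)
  qed
  define Z where "Z = 2 * int n * int p ^ 2 * (-1) ^ r * (?c * ?ca * ?cb * (2 * int b + 1))"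
  have sgn: "(-1::int) ^ r = - ((-1) ^ (r - 1))" using assms(2) by (cases r) auto
  have "[(int r * ?C) * (int r * (?A * ?B)) = ((-1) ^ (r - 1) * (int n * int p * ?c)) *
      (?ca * ?cb * (2 * int b + 1) * (- 2 * int p))] (mod ?q)"
    using C d1 AB by (rule cong_mult_left_power) simp
  then have 1: "[int r ^ 2 * S_term (n * p) (p * a + r) = Z] (mod ?q)"
    unfolding t by (simp only: Z_def sgn power2_eq_square mult_ac mult_minus_left mult_minus_right mult_1 minus_minus)
  have "int p ^ e * int p ^ 2 dvd int n * int p ^ 2" using assms(5) by (intro mult_dvd_mono) auto
  then have "int p ^ (e + 2) dvd int n * int p ^ 2 * (2 * (-1) ^ r * (?c * ?ca * ?cb * (2 * int b + 1)))"
    unfolding power_add by (rule dvd_mult2)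
  then have dZ: "int p ^ (e + 2) dvd Z" by (simp only: Z_def mult_ac)
  have pr: "\<not> int p dvd int r" using assms(2) rs(1) by (auto dest: dvd_imp_le)
  then have cop: "coprime (int r) (int p)"
    using prime_p by (metis coprime_commute prime_imp_coprime prime_nat_int_transfer)
  have f: "[int r ^ (2 * (m - 1)) * int r ^ 2 = 1] (mod int p)"
  proof -
    have "int r ^ (2 * (m - 1)) * int r ^ 2 = int r ^ (p - 1)"
      unfolding power_add[symmetric] by (rule arg_cong[where f = "\<lambda>k. int r ^ k"]) (use assms in simp)
    then show ?thesis using fermat_int[OF prime_p pr] by simp
  qed
  \<comment> \<open>Since p^(e+2) divides \<open>Z\<close>, it suffices that r^(p-3) inverts r^2
    modulo \<open>p\<close>.\<close>
  have "[int r ^ 2 * (int r ^ (2 * (m - 1)) * Z) = Z] (mod ?q)"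
  proof -
    have "int p * int p ^ (e + 2) dvd (int r ^ (2 * (m - 1)) * int r ^ 2 - 1) * Z"
      using f dZ by (intro mult_dvd_mono) (auto simp: cong_iff_dvd_diff)
    then show ?thesis by (simp add: cong_iff_dvd_diff algebra_simps eval_nat_numeral)
  qed
  with 1 have "[int r ^ 2 * S_term (n * p) (p * a + r) = int r ^ 2 * (int r ^ (2 * (m - 1)) * Z)] (mod ?q)"
    by (metis cong_sym cong_trans)
  moreover have "coprime (int r ^ 2) ?q" using cop by simp
  ultimately have "[S_term (n * p) (p * a + r) = int r ^ (2 * (m - 1)) * Z] (mod ?q)"
    using cong_mult_lcancel by blast
  then show ?thesis by (simp add: Z_def S_term_def b_def mult_ac)
qed

lemma nonmultiple_sum_cong:
  assumes "p = 2 * m + 1" "int p ^ e dvd int n"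
  shows "[(\<Sum>a<n. \<Sum>r=1..<p. S_term (n * p) (p * a + r)) =
    4 * int n ^ 2 * int p ^ 2 * (\<Sum>r=1..m. (-1) ^ r * int r ^ (2 * (m - 1))) * S (n - 1)] (mod int p ^ (e + 3))"
proof -
  let ?h = "\<lambda>r. (-1) ^ r * int r ^ (2 * (m - 1))" and ?w = "\<lambda>a. S_term (n - 1) a * (2 * int (n - 1 - a) + 1)"
  have "[2 * (\<Sum>a<n. \<Sum>r=1..m. S_term (n * p) (p * a + r)) =
    2 * (\<Sum>a<n. \<Sum>r=1..m. 2 * int n * int p ^ 2 * ?h r * ?w a)] (mod int p ^ (e + 3))"
    using assms by (intro cong_scalar_left cong_sum nonmultiple_term_cong) auto
  also have "(\<Sum>a<n. \<Sum>r=1..m. 2 * int n * int p ^ 2 * ?h r * ?w a) =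
    2 * int n * int p ^ 2 * (\<Sum>r=1..m. ?h r) * (\<Sum>a<n. ?w a)"
    by (subst sum.swap) (simp only: sum_distrib_left sum_distrib_right mult_ac)
  also have "2 * \<dots> = 4 * int n ^ 2 * int p ^ 2 * (\<Sum>r=1..m. ?h r) * S (n - 1)"
    unfolding S_sum_weighted by (simp add: power2_eq_square)
  finally show ?thesis unfolding sum_nonmultiples_half[OF assms(1)] .
qed

lemma multiple_sum_cong:
  assumes "int p ^ e dvd int n"
  shows "[(\<Sum>a\<le>n. S_term (n * p) (p * a)) =
    S n + D * (2 * int n ^ 3 * S n - 5 * int n * (\<Sum>a\<le>n. S_term n a * (int a * int (n - a))))] (mod int p ^ (e + 3))"
proof -
  have "[(\<Sum>a\<le>n. S_term (n * p) (p * a)) =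
    (\<Sum>a\<le>n. S_term n a * (1 + D * (2 * int n ^ 3 - 5 * int n * int a * int (n - a))))] (mod int p ^ (e + 3))"
  proof (rule cong_sum)
    fix a assume "a \<in> {..n}"
    then obtain b where n: "n = a + b" by (auto simp: le_iff_add)
    have "n * p - p * a = p * b" by (simp add: n algebra_simps)
    then show "[S_term (n * p) (p * a) = S_term n a * (1 + D * (2 * int n ^ 3 - 5 * int n * int a * int (n - a)))] (mod int p ^ (e + 3))"
      using multiple_term_cong[of e a b] assms unfolding S_term_def n
      by (simp add: mult.commute[of _ p] add.commute[of e])
  qed
  also have "(\<Sum>a\<le>n. S_term n a * (1 + D * (2 * int n ^ 3 - 5 * int n * int a * int (n - a)))) =
    S n + D * (2 * int n ^ 3 * S n - 5 * int n * (\<Sum>a\<le>n. S_term n a * (int a * int (n - a))))"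
    by (simp add: S_eq_sum_S_term sum_distrib_left sum_distrib_right algebra_simps sum.distrib sum_subtractf)
  finally show ?thesis .
qed

lemma S_mult_cong:
  assumes "p = 2 * m + 1" "int p ^ e dvd int n"
  shows "[S (n * p) - S n = D * (2 * int n ^ 3 * S n - 5 * int n * (\<Sum>a\<le>n. S_term n a * (int a * int (n - a)))) +
    4 * int n ^ 2 * int p ^ 2 * (\<Sum>r=1..m. (-1) ^ r * int r ^ (2 * (m - 1))) * S (n - 1)] (mod int p ^ (e + 3))"
  using cong_diff[OF cong_add[OF multiple_sum_cong[OF assms(2)] nonmultiple_sum_cong[OF assms]] cong_refl[of "S n"]]
  unfolding S_eq_sum_S_term[of "n * p"] sum_split_multiples[OF p_pos] by simp

end

section \<open>Lucas congruences\<close>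

lemma sum_lessThan_mult:
  fixes f :: "nat \<Rightarrow> 'a::comm_monoid_add"
  shows "(\<Sum>j<p * k. f j) = (\<Sum>a<k. \<Sum>r<p. f (p * a + r))"
proof (induction k)
  case (Suc k)
  have "(\<Sum>j<p * k + l. f j) = (\<Sum>j<p * k. f j) + (\<Sum>r<l. f (p * k + r))" for l
    by (induction l) (simp_all add: ac_simps)
  from this[of p] show ?case by (simp add: Suc add.commute)
qed simp

context block_expansion
begin

text \<open>Induction on the low digit \<open>i\<close> by Pascal's rule.\<close>

lemma binomial_lucas:
  assumes "i < p" "r < p"
  shows "[int ((p * k + i) choose (p * a + r)) = int (k choose a) * int (i choose r)] (mod int p)"
  using assms
proof (induction i arbitrary: a r)
  case 0
  show ?case
  proof (cases "r = 0")
    case False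
    then have "\<not> p dvd r" using 0 by (auto dest: dvd_imp_le)
    then have "\<not> p dvd p * a + r" by (metis dvd_add_right_iff dvd_triv_left)
    then have "int p dvd int ((k * p) choose (p * a + r))"
      using dvd_binomial_nonmultiple[of "p * a + r" 0 k] by simp
    then show ?thesis using False by (simp add: cong_0_iff mult.commute binomial_eq_0)
  next
    case True
    show ?thesis
    proof (cases "a \<le> k")
      case True
      then obtain b where k: "k = a + b" by (auto simp: le_iff_add)
      have "[1 * int ((p * (a + b)) choose (p * a)) = 1 * int ((a + b) choose a) *
        (1 + D * (int a * int b * (int a + int b)))] (mod int p ^ (3 + 0))"
        by (rule binomial_mult_cong) simp
      then have "[1 * int ((p * (a + b)) choose (p * a)) = 1 * int ((a + b) choose a) *
        (1 + D * (int a * int b * (int a + int b)))] (mod int p)"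
        by (rule cong_dvd_modulus) (simp add: power3_eq_cube)
      also have "[1 * int ((a + b) choose a) * (1 + D * (int a * int b * (int a + int b))) =
        1 * int ((a + b) choose a) * (1 + 0 * (int a * int b * (int a + int b)))] (mod int p)"
        by (intro cong_mult cong_add cong_refl p_dvd_D)
      finally show ?thesis using \<open>r = 0\<close> by (simp add: k)
    next
      case False
      then have "p * k < p * a" using p_pos by simp
      then show ?thesis using \<open>r = 0\<close> False by (simp add: binomial_eq_0)
    qed
  qed
next
  case (Suc i)
  show ?case
  proof (cases r)
    case (Suc r')
    have "[int ((p * k + i) choose (p * a + r')) + int ((p * k + i) choose (p * a + r)) =
      int (k choose a) * int (i choose r') + int (k choose a) * int (i choose r)] (mod int p)"
      using Suc.prems Suc by (intro cong_add Suc.IH) auto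
    then show ?thesis using Suc by (simp add: algebra_simps)
  next
    case 0
    show ?thesis
    proof (cases a)
      case (Suc a')
      \<comment> \<open>For r = 0 the left neighbour of column pa has digits a - 1 and p - 1. Its
        term vanishes because i < p - 1.\<close>
      obtain q where q: "p = Suc q" using p_pos by (cases p) auto
      have "[int ((p * k + i) choose (p * a' + q)) + int ((p * k + i) choose (p * a + 0)) =
        int (k choose a') * int (i choose q) + int (k choose a) * int (i choose 0)] (mod int p)"
        using Suc.prems q by (intro cong_add Suc.IH) auto
      moreover have "i choose q = 0" using Suc.prems q by (simp add: binomial_eq_0)
      moreover have "p * a = Suc (p * a' + q)" using Suc q by simp
      then have "(p * k + Suc i) choose (p * a) = ((p * k + i) choose (p * a' + q)) + ((p * k + i) choose (p * a))"
        by simp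
      ultimately show ?thesis using 0 by simp
    qed (use 0 in simp)
  qed
qed

lemma S_term_lucas:
  assumes "i < p" "r < p" "a \<le> k"
  shows "[S_term (p * k + i) (p * a + r) = S_term k a * S_term i r] (mod int p)"
proof (cases "r \<le> i")
  case True
  obtain b where b: "k = a + b" using assms(3) by (auto simp: le_iff_add)
  have "p * k + i - (p * a + r) = p * b + (i - r)"
    using True by (simp add: b distrib_left)
  moreover have "[int ((p * k + i) choose (p * a + r)) * int ((2 * (p * a + r)) choose (p * a + r)) *
      int ((2 * (p * b + (i - r))) choose (p * b + (i - r))) =
      (int (k choose a) * int (i choose r)) * (int ((2 * a) choose a) * int ((2 * r) choose r)) *
      (int ((2 * b) choose b) * int ((2 * (i - r)) choose (i - r)))] (mod int p)"
    using assms by (intro cong_mult binomial_lucas central_binomial_lucas) auto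
  ultimately show ?thesis by (simp add: S_term_def b mult_ac)
next
  case False
  then have z: "i choose r = 0" by (simp add: binomial_eq_0)
  have "int p dvd int ((p * k + i) choose (p * a + r))"
    using binomial_lucas[OF assms(1,2), of k a] unfolding z by (simp add: cong_0_iff)
  then have "int p dvd S_term (p * k + i) (p * a + r)"
    unfolding S_term_def by (intro dvd_mult2)
  then show ?thesis by (simp add: S_term_def[of i] z cong_0_iff)
qed

text \<open>Terms beyond the upper limit vanish, so the range can be filled up to whole blocks of
  length \<open>p\<close>, where digits separate; modulo \<open>p\<close> the weight sees only the
  low digit.\<close>

lemma S_weighted_lucas:
  assumes "i < p" "\<And>a r. [g (p * a + r) = h r] (mod int p)"
  shows "[(\<Sum>j\<le>p * k + i. S_term (p * k + i) j * g j) = S k * (\<Sum>r\<le>i. S_term i r * h r)] (mod int p)"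
proof -
  have z: "S_term n j = 0" if "j > n" for n j using that by (simp add: S_term_def binomial_eq_0)
  have "(\<Sum>j\<le>p * k + i. S_term (p * k + i) j * g j) = (\<Sum>j<p * Suc k. S_term (p * k + i) j * g j)"
    by (rule sum.mono_neutral_left) (use assms(1) in \<open>auto simp: z\<close>)
  also have "\<dots> = (\<Sum>a\<le>k. \<Sum>r<p. S_term (p * k + i) (p * a + r) * g (p * a + r))"
    unfolding sum_lessThan_mult lessThan_Suc_atMost ..
  also have "[\<dots> = (\<Sum>a\<le>k. \<Sum>r<p. (S_term k a * S_term i r) * h r)] (mod int p)"
    using assms by (intro cong_sum cong_mult S_term_lucas) auto
  also have "(\<Sum>a\<le>k. \<Sum>r<p. (S_term k a * S_term i r) * h r) = S k * (\<Sum>r<p. S_term i r * h r)"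
    by (simp add: S_eq_sum_S_term sum_product mult.assoc)
  also have "(\<Sum>r<p. S_term i r * h r) = (\<Sum>r\<le>i. S_term i r * h r)"
    by (rule sum.mono_neutral_right) (use assms(1) in \<open>auto simp: z\<close>)
  finally show ?thesis .
qed

lemma S_lucas: "i < p \<Longrightarrow> [S (p * k + i) = S k * S i] (mod int p)"
  using S_weighted_lucas[of i "\<lambda>_. 1" "\<lambda>_. 1" k] by (simp add: S_eq_sum_S_term)

lemma S_product_weighted_lucas:
  assumes "i < p"
  shows "[(\<Sum>j\<le>p * k + i. S_term (p * k + i) j * (int j * int (p * k + i - j))) =
    S k * (\<Sum>r\<le>i. S_term i r * (int r * (int i - int r)))] (mod int p)"
proof -
  have "(\<Sum>j\<le>p * k + i. S_term (p * k + i) j * (int j * int (p * k + i - j))) =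
    (\<Sum>j\<le>p * k + i. S_term (p * k + i) j * (int j * (int (p * k + i) - int j)))"
    by (rule sum.cong) (auto simp: of_nat_diff)
  also have "[\<dots> = S k * (\<Sum>r\<le>i. S_term i r * (int r * (int i - int r)))] (mod int p)"
  proof (rule S_weighted_lucas[OF assms])
    fix a r
    have c: "[int (p * x + y) = int y] (mod int p)" for x y by (simp add: cong_iff_dvd_diff)
    show "[int (p * a + r) * (int (p * k + i) - int (p * a + r)) = int r * (int i - int r)] (mod int p)"
      by (intro cong_mult cong_diff c)
  qed
  finally show ?thesis .
qed

end

section \<open>The residue modulo 3 needed for p = 3\<close>

lemma S_values: "S 0 = 1" "S 1 = 4" "S 2 = 20"
  by (simp_all add: S_def eval_nat_numeral)

text \<open>The left side is that of \<open>S_mult_cong\<close> for p = 3, D = -9 after division by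
  9; the sum over r there is -1. By the Lucas congruences \<open>S n\<close>, \<open>X\<close> and
  \<open>S (n - 1)\<close> are \<open>S k\<close> times their values for the last ternary digit,
  which leaves two cases.\<close>

lemma S_mult_3_residue:
  assumes "\<not> 3 dvd n"
  defines "X \<equiv> \<Sum>a\<le>n. S_term n a * (int a * int (n - a))"
  shows "[- 2 * int n ^ 3 * S n + 5 * int n * X - 4 * int n ^ 2 * S (n - 1) = (int n - 1) * S n] (mod 3)"
proof -
  interpret block_expansion 3 "- 9" by (rule block_expansion_3)
  define k where "k = n div 3"
  have reduce: "[- 2 * int n ^ 3 * S n + 5 * int n * X - 4 * int n ^ 2 * S (n - 1) =
      - 2 * x ^ 3 * u + 5 * x * v - 4 * x ^ 2 * w] (mod 3)" "[(int n - 1) * S n = (x - 1) * u] (mod 3)"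
    if "[int n = x] (mod 3)" "[S n = u] (mod 3)" "[X = v] (mod 3)" "[S (n - 1) = w] (mod 3)" for x u v w
    using that by (intro cong_add cong_diff cong_mult cong_pow cong_refl; simp)+
  have "n mod 3 = 1 \<or> n mod 3 = 2" using assms(1) by presburger
  then show ?thesis
  proof
    assume "n mod 3 = 1"
    then have n: "n = 3 * k + 1" unfolding k_def by presburger
    have 1: "[int n = 1] (mod 3)" by (simp add: n cong_iff_dvd_diff)
    have 2: "[S n = S k * 4] (mod 3)" using S_lucas[of 1 k] by (simp add: n S_values[simplified])
    have 3: "[S (n - 1) = S k * 1] (mod 3)" using S_lucas[of 0 k] by (simp add: n S_values)
    have 4: "[X = S k * 0] (mod 3)" using S_product_weighted_lucas[of 1 k] by (simp add: n X_def S_term_def)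
    from reduce[OF 1 2 4 3] show ?thesis by (simp add: cong_def)
  next
    assume "n mod 3 = 2"
    then have n: "n = 3 * k + 2" unfolding k_def by presburger
    have 1: "[int n = 2] (mod 3)" by (simp add: n cong_iff_dvd_diff)
    have 2: "[S n = S k * 20] (mod 3)" using S_lucas[of 2 k] by (simp add: n S_values)
    have 3: "[S (n - 1) = S k * 4] (mod 3)" using S_lucas[of 1 k] by (simp add: n S_values[simplified])
    have 4: "[X = S k * 8] (mod 3)" using S_product_weighted_lucas[of 2 k]
      by (simp add: n X_def S_term_def eval_nat_numeral)
    have "[- 2 * 2 ^ 3 * (S k * 20) + 5 * 2 * (S k * 8) - 4 * 2 ^ 2 * (S k * 4) = (2 - 1) * (S k * 20)] (mod 3)"
      by (simp add: cong_iff_dvd_diff)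
    from cong_trans[OF reduce(1)[OF 1 2 4 3] cong_trans[OF this cong_sym[OF reduce(2)[OF 1 2 4 3]]]]
    show ?thesis .
  qed
qed

section \<open>The main congruences\<close>

theorem theorem3p1:
  fixes p n :: nat
  assumes "prime p" and "odd p" and "n > 0"
  shows "(p > 3 \<and> \<not> p dvd n \<longrightarrow>
           [S (n*p) - S n = 8 * int n^2 * S (n-1) * (-1)^((p-1) div 2) * int p^2 * E (p-3)] (mod int p^3))
       \<and> (p = 3 \<and> \<not> 3 dvd n \<longrightarrow>
           [S (n*p) - S n = 9 * (int n - 1) * S n] (mod int p^3))
       \<and> (p dvd n \<longrightarrow>
           [S (n*p) - S n = 0] (mod int p^(3 + multiplicity p n)))"
proof (intro conjI impI)
  obtain m where m: "p = 2 * m + 1" using assms(2) by (elim oddE)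
  {
    assume p: "p > 3 \<and> \<not> p dvd n"
    interpret block_expansion p 0 using assms(1) p by (intro block_expansion_gt_3) auto
    let ?H = "\<Sum>r=1..m. (-1) ^ r * int r ^ (2 * (m - 1))"
    have "m > 1" using p m by simp
    have "[?H = 2 * (-1) ^ m * euler_even (m - 1)] (mod int p)"
      using alternating_power_sum_cong_euler[OF assms(1) m \<open>m > 1\<close>] .
    then have "int p ^ 2 * int p dvd int p ^ 2 * (?H - 2 * (-1) ^ m * euler_even (m - 1))"
      by (intro mult_dvd_mono) (auto simp: cong_iff_dvd_diff)
    then have "[int p ^ 2 * ?H = int p ^ 2 * (2 * (-1) ^ m * euler_even (m - 1))] (mod int p ^ 3)"
      unfolding cong_iff_dvd_diff right_diff_distrib by (simp add: power2_eq_square power3_eq_cube)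
    then have 1: "[4 * int n ^ 2 * S (n - 1) * (int p ^ 2 * ?H) =
      4 * int n ^ 2 * S (n - 1) * (int p ^ 2 * (2 * (-1) ^ m * euler_even (m - 1)))] (mod int p ^ 3)"
      by (rule cong_scalar_left)
    have "p - 3 = 2 * (m - 1)" using m by simp
    then have "E (p - 3) = euler_even (m - 1)" by (simp add: E_def)
    moreover have "(p - 1) div 2 = m" using m by simp
    moreover have "[S (n * p) - S n = 4 * int n ^ 2 * S (n - 1) * (int p ^ 2 * ?H)] (mod int p ^ 3)"
      using S_mult_cong[OF m, of 0 n] by (simp add: mult_ac)
    moreover note cong_trans[OF this 1]
    ultimately show "[S (n*p) - S n = 8 * int n^2 * S (n-1) * (-1)^((p-1) div 2) * int p^2 * E (p-3)] (mod int p^3)"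
      by (simp add: mult_ac)
  next
    assume p: "p = 3 \<and> \<not> 3 dvd n"
    interpret block_expansion 3 "- 9" by (rule block_expansion_3)
    let ?X = "\<Sum>a\<le>n. S_term n a * (int a * int (n - a))"
    let ?Y = "- 2 * int n ^ 3 * S n + 5 * int n * ?X - 4 * int n ^ 2 * S (n - 1)"
    have 1: "[S (n * 3) - S n = 9 * ?Y] (mod 27)"
      using S_mult_cong[of 1 0 n] by (simp add: algebra_simps)
    have "[9 * ?Y = 9 * ((int n - 1) * S n)] (mod 9 * 3)"
      using S_mult_3_residue[of n] p by (intro cong_cmult_leftI) auto
    then have "[9 * ?Y = 9 * (int n - 1) * S n] (mod 27)" by (simp only: mult.assoc) simp
    from cong_trans[OF 1 this] show "[S (n*p) - S n = 9 * (int n - 1) * S n] (mod int p^3)"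
      using p by simp
  next
    assume p: "p dvd n"
    obtain D where "block_expansion p D"
    proof (cases "p = 3")
      case False
      have "p > 3" using m prime_gt_1_nat[OF assms(1)] False by (cases "m = 0"; cases "m = 1") auto
      then show ?thesis using that block_expansion_gt_3 assms(1) by blast
    next
      case True
      then show ?thesis using that[of "- 9"] block_expansion_3 by simp
    qed
    then interpret block_expansion p D .
    define e where "e = multiplicity p n"
    have e: "int p ^ e dvd int n" unfolding e_def by (metis int_dvd_int_iff multiplicity_dvd of_nat_power)
    have "e > 0" unfolding e_def
      using p assms(1,3) prime_gt_1_nat[OF assms(1)] by (subst multiplicity_gt_zero_iff) auto
    let ?X = "\<Sum>a\<le>n. S_term n a * (int a * int (n - a))"
    let ?H = "\<Sum>r=1..m. (-1) ^ r * int r ^ (2 * (m - 1))"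
    have X: "int p ^ e dvd ?X"
    proof (rule dvd_sum)
      fix a assume "a \<in> {..n}"
      then have "int n dvd int (n choose a) * int a"
        using add_dvd_mult_binomial[of a "n - a"] by simp
      then have "int n dvd (int (n choose a) * int a) * (int ((2 * a) choose a) * int ((2 * (n - a)) choose (n - a)) * int (n - a))"
        by (rule dvd_mult2)
      then have "int n dvd S_term n a * (int a * int (n - a))"
        by (simp add: S_term_def mult_ac)
      then show "int p ^ e dvd S_term n a * (int a * int (n - a))" using e dvd_trans by blast
    qed
    \<comment> \<open>The hypothesis that \<open>p\<close> divides \<open>n\<close> enters here: 2 +
      2e reaches e + 3 once e is positive.\<close>
    have q: "int p ^ (e + 3) dvd int p ^ 2 * (int p ^ e * int p ^ e)"
      unfolding power_add[symmetric] using \<open>e > 0\<close> by (intro le_imp_power_dvd) simp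
    have "int p ^ 2 * (int p ^ e * int p ^ e) dvd D * (int n * (2 * int n ^ 2 * S n - 5 * ?X))"
      using e X by (intro mult_dvd_mono D_dvd dvd_diff dvd_mult dvd_mult2) (auto simp: power2_eq_square)
    moreover have "int p ^ 2 * (int p ^ e * int p ^ e) dvd int p ^ 2 * (int n * int n) * (4 * ?H * S (n - 1))"
      using e by (intro dvd_mult2 mult_dvd_mono) auto
    ultimately have "int p ^ (e + 3) dvd D * (int n * (2 * int n ^ 2 * S n - 5 * ?X)) + int p ^ 2 * (int n * int n) * (4 * ?H * S (n - 1))"
      by (intro dvd_add dvd_trans[OF q])
    also have "\<dots> = D * (2 * int n ^ 3 * S n - 5 * int n * ?X) + 4 * int n ^ 2 * int p ^ 2 * ?H * S (n - 1)"
      by (simp add: algebra_simps power2_eq_square power3_eq_cube)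
    finally have "int p ^ (e + 3) dvd S (n * p) - S n"
      using cong_dvd_iff[OF S_mult_cong[OF m e]] by blast
    then show "[S (n*p) - S n = 0] (mod int p^(3 + multiplicity p n))"
      by (simp add: cong_0_iff e_def add.commute)
  }
qed

end
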